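(* Let $\Lambda>0$ and $\tau\ge 0$, $\tau\neq 1/(2\Lambda)$, and let $V(\tau)=g^{i\bar j}(\tau)\,\partial_i W\,\bar\partial_{\bar j}\bar W$ be the scalar potential of the global $N=1$ chiral theory with holomorphic superpotential $W$ on the evolving Kähler--Einstein manifold with metric $g_{i\bar j}(\tau)=\sigma(\tau)g_{i\bar j}(0)$, $\sigma(\tau)=1-2\Lambda\tau$. If $p_0$ is an isolated (nondegenerate) supersymmetric vacuum of Morse index $\lambda$ (for $0\le\tau<1/(2\Lambda)$), then there is a parity transformation of the Hessian matrix of $V(\tau)$ at $p_0$, due to the deformation of the Kähler--Einstein manifold, that changes the index $\lambda$ to the Morse index $2n_c-\lambda$ (for $\tau>1/(2\Lambda)$). Furthermore, around $p_0$ one can introduce real local coordinates $X_p(\tau)=|\sigma(\tau)|^{-1/2}X_p(0)$, $p=1,\dots,2n_c$, such that $$V(\tau)=\varepsilon(\sigma)\Big(-X_1^2(\tau)-\cdots-X_\lambda^2(\tau)+X_{\lambda+1}^2(\tau)+\cdots+X_{2n_c}^2(\tau)\Big),$$ where $\varepsilon(\sigma)=1$ if $0\le\tau<1/(2\Lambda)$ and $\varepsilon(\sigma)=-1$ if $\tau>1/(2\Lambda)$.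
   Context: Setting: $\mathbf M$ is a complex manifold of complex dimension $n_c$ (not necessarily compact; e.g. a coordinate domain) with local holomorphic coordinates $z^i$, $i=1,\dots,n_c$, and an initial Kähler metric $g_{i\bar j}(0)=\partial_i\bar\partial_{\bar j}K(0)$ (possibly indefinite) which is Kähler--Einstein, $R_{i\bar j}(0)=\Lambda g_{i\bar j}(0)$ with $\Lambda\in\mathbb R$. Under the Kähler--Ricci flow $\partial_\tau g_{i\bar j}=-2R_{i\bar j}$ the metric is $g_{i\bar j}(\tau)=\sigma(\tau)g_{i\bar j}(0)$, $\sigma(\tau)=1-2\Lambda\tau$, and this formula is also used for $\tau>1/(2\Lambda)$; $g^{i\bar j}(\tau)$ denotes the inverse metric. $W=W(z)$ is a holomorphic function (superpotential). The scalar potential is the real function $V(z,\bar z;\tau)=g^{i\bar j}(\tau)\partial_iW\,\bar\partial_{\bar j}\bar W=\sigma(\tau)^{-1}V(z,\bar z;0)$ (summation convention). A supersymmetric vacuum (ground state) is a point $p_0=(z_0,\bar z_0)$ with $\partial_iW(z_0)=0$ for all $i$; it is then a critical point of $V(\tau)$ and does not depend on $\tau$. It is assumed that $g_{i\bar j}(p_0;0)$ is invertible. "Isolated" means that $p_0$ is a nondegenerate critical point of $V(\tau)$, i.e. the real $2n_c\times 2n_c$ Hessian of $V(\tau)$ at $p_0$ is invertible; the Morse index is the number of its negative eigenvalues. A "parity transformation" of the Hessian matrix means the overall sign reversal (up to a positive factor) of the Hessian at the vacuum when $\tau$ passes from $\tau<1/(2\Lambda)$ to $\tau>1/(2\Lambda)$.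 *)

theory Defs
  imports "HOL-Analysis.Analysis"
begin

section \<open>Differential calculus in coordinates\<close>

definition partial_derivative ::
    "'v::real_normed_vector \<Rightarrow> ('v \<Rightarrow> 'w::real_normed_vector) \<Rightarrow> 'v \<Rightarrow> 'w" where
  "partial_derivative v f x = vector_derivative (\<lambda>t. f (x + t *\<^sub>R v)) (at 0)"

text \<open>Only meant for open sets.\<close>

primrec k_times_differentiable_on ::
    "nat \<Rightarrow> ('v::euclidean_space \<Rightarrow> 'w::real_normed_vector) \<Rightarrow> 'v set \<Rightarrow> bool" where
  "k_times_differentiable_on 0 f S \<longleftrightarrow> continuous_on S f"
| "k_times_differentiable_on (Suc k) f S \<longleftrightarrow>
     f differentiable_on S \<and>
     (\<forall>v\<in>Basis. k_times_differentiable_on k (partial_derivative v f) S)"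

definition smooth_on ::
    "('v::euclidean_space \<Rightarrow> 'w::real_normed_vector) \<Rightarrow> 'v set \<Rightarrow> bool" where
  "smooth_on f S \<longleftrightarrow> (\<forall>k. k_times_differentiable_on k f S)"

definition wirtinger :: "'n::finite \<Rightarrow> (complex^'n \<Rightarrow> complex) \<Rightarrow> complex^'n \<Rightarrow> complex" where
  "wirtinger i f z =
     (partial_derivative (axis i 1) f z - \<i> * partial_derivative (axis i \<i>) f z) / 2"

definition wirtinger_bar :: "'n::finite \<Rightarrow> (complex^'n \<Rightarrow> complex) \<Rightarrow> complex^'n \<Rightarrow> complex" where
  "wirtinger_bar i f z =
     (partial_derivative (axis i 1) f z + \<i> * partial_derivative (axis i \<i>) f z) / 2"

text \<open>Holomorphy in several variables: the Frechet derivative exists and is complex linear.\<close>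

definition multi_holomorphic_on :: "(complex^'n::finite \<Rightarrow> complex) \<Rightarrow> (complex^'n) set \<Rightarrow> bool" where
  "multi_holomorphic_on f S \<longleftrightarrow>
     (\<forall>z\<in>S. \<exists>f'. (f has_derivative f') (at z) \<and> (\<forall>c v. f' (c *s v) = c * f' v))"

section \<open>Complex manifolds\<close>

text \<open>A chart is a pair of its domain and its coordinate map. The complex dimension is the
  cardinality of the index type \<open>'n\<close>.\<close>

type_synonym ('a, 'n) chart = "'a set \<times> ('a \<Rightarrow> complex^'n)"

definition local_coordinates ::
    "'a topology \<Rightarrow> 'a set \<Rightarrow> ('a \<Rightarrow> 'v::euclidean_space) \<Rightarrow> bool" where
  "local_coordinates M U \<phi> \<longleftrightarrow>
     openin M U \<and> open (\<phi> ` U) \<and> homeomorphic_map (subtopology M U) (top_of_set (\<phi> ` U)) \<phi>"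

definition complex_manifold :: "'a topology \<Rightarrow> ('a, 'n::finite) chart set \<Rightarrow> bool" where
  "complex_manifold M A \<longleftrightarrow>
     Hausdorff_space M \<and> second_countable M \<and>
     topspace M = (\<Union>(U, \<phi>)\<in>A. U) \<and>
     (\<forall>(U, \<phi>)\<in>A. local_coordinates M U \<phi>) \<and>
     (\<forall>(U, \<phi>)\<in>A. \<forall>(U', \<phi>')\<in>A. \<forall>k.
        multi_holomorphic_on (\<lambda>z. \<phi>' (inv_into U \<phi> z) $ k) (\<phi> ` (U \<inter> U')))"

definition holomorphic_function ::
    "('a, 'n::finite) chart set \<Rightarrow> ('a \<Rightarrow> complex) \<Rightarrow> bool" where
  "holomorphic_function A W \<longleftrightarrow>
     (\<forall>(U, \<phi>)\<in>A. multi_holomorphic_on (\<lambda>z. W (inv_into U \<phi> z)) (\<phi> ` U))"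

text \<open>Real local coordinates of the underlying smooth manifold of real dimension \<open>2 * CARD('n)\<close>.\<close>

definition real_coordinates ::
    "'a topology \<Rightarrow> ('a, 'n::finite) chart set \<Rightarrow> 'a set \<Rightarrow> ('a \<Rightarrow> real^('n + 'n)) \<Rightarrow> bool" where
  "real_coordinates M A N X \<longleftrightarrow>
     local_coordinates M N X \<and>
     (\<forall>(U, \<phi>)\<in>A.
        smooth_on (\<lambda>z. X (inv_into U \<phi> z)) (\<phi> ` (U \<inter> N)) \<and>
        smooth_on (\<lambda>x. \<phi> (inv_into N X x)) (X ` (U \<inter> N)))"

section \<open>Kaehler--Einstein metrics and their evolution\<close>

text \<open>A metric assigns to every chart the matrix-valued function of its components
  \<open>g\<^bsub>i \<bar>j\<^esub>\<close>, as a function of the coordinates \<open>z \<in> \<phi> ` U\<close>.\<close>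

type_synonym ('a, 'n) metric = "('a, 'n) chart \<Rightarrow> complex^'n \<Rightarrow> complex^'n^'n"

text \<open>The metric has a smooth real potential near every point and transforms as a tensor.
  Neither definiteness nor invertibility is required here; invertibility is
  imposed separately, at the vacuum.\<close>

definition kaehler_metric :: "('a, 'n::finite) chart set \<Rightarrow> ('a, 'n) metric \<Rightarrow> bool" where
  "kaehler_metric A g \<longleftrightarrow>
     (\<forall>(U, \<phi>)\<in>A. \<forall>p\<in>U. \<exists>S K. open S \<and> \<phi> p \<in> S \<and> S \<subseteq> \<phi> ` U \<and>
        smooth_on (K :: complex^'n \<Rightarrow> real) S \<and>
        (\<forall>z\<in>S. \<forall>i j.
           g (U, \<phi>) z $ i $ j = wirtinger i (wirtinger_bar j (\<lambda>w. of_real (K w))) z)) \<and>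
     (\<forall>(U, \<phi>)\<in>A. \<forall>(U', \<phi>')\<in>A. \<forall>p\<in>U \<inter> U'. \<forall>i j.
        g (U, \<phi>) (\<phi> p) $ i $ j =
          (\<Sum>k\<in>UNIV. \<Sum>l\<in>UNIV.
             wirtinger i (\<lambda>z. \<phi>' (inv_into U \<phi> z) $ k) (\<phi> p) *
             cnj (wirtinger j (\<lambda>z. \<phi>' (inv_into U \<phi> z) $ l) (\<phi> p)) *
             g (U', \<phi>') (\<phi>' p) $ k $ l))"

text \<open>The Ricci tensor is \<open>- \<partial>\<^sub>i \<bar>\<partial>\<^sub>j ln det g\<close>. The determinant is real but may be negative
  for an indefinite metric, hence the modulus.\<close>

definition ricci :: "(complex^'n::finite \<Rightarrow> complex^'n^'n) \<Rightarrow> complex^'n \<Rightarrow> complex^'n^'n" where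
  "ricci h z =
     (\<chi> i j. - wirtinger i (wirtinger_bar j (\<lambda>w. of_real (ln (cmod (det (h w)))))) z)"

text \<open>The Einstein equation is imposed wherever the Ricci tensor makes sense.\<close>

definition kaehler_einstein ::
    "('a, 'n::finite) chart set \<Rightarrow> real \<Rightarrow> ('a, 'n) metric \<Rightarrow> bool" where
  "kaehler_einstein A \<Lambda> g \<longleftrightarrow>
     kaehler_metric A g \<and>
     (\<forall>(U, \<phi>)\<in>A. \<forall>z\<in>\<phi> ` U.
        invertible (g (U, \<phi>) z) \<longrightarrow> ricci (g (U, \<phi>)) z = \<Lambda> *\<^sub>R g (U, \<phi>) z)"

text \<open>A constant rescaling of the metric does not change its Ricci tensor, so the evolution
  \<open>\<partial>g/\<partial>\<tau> = - 2 Ric\<close> of a Kaehler--Einstein metric is the rescaling below. It is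
  used on both sides of the singular time \<open>1 / (2 * \<Lambda>)\<close>.\<close>

definition flow_factor :: "real \<Rightarrow> real \<Rightarrow> real" where
  "flow_factor \<Lambda> \<tau> = 1 - 2 * \<Lambda> * \<tau>"

definition evolved_metric :: "real \<Rightarrow> ('a, 'n::finite) metric \<Rightarrow> real \<Rightarrow> ('a, 'n) metric" where
  "evolved_metric \<Lambda> g \<tau> c z = flow_factor \<Lambda> \<tau> *\<^sub>R g c z"

section \<open>Scalar potential and supersymmetric vacua\<close>

text \<open>The upper-index components are normalised by \<open>\<Sum>\<^sub>j g\<^bsup>i \<bar>j\<^esup> g\<^bsub>k \<bar>j\<^esub> = \<delta>\<^sup>i\<^sub>k\<close>, which is the
  inverse of the \<^emph>\<open>transposed\<close> matrix of lower-index components.\<close>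

definition inverse_metric :: "complex^'n^'n::finite \<Rightarrow> complex^'n^'n" where
  "inverse_metric h = matrix_inv (transpose h)"

text \<open>The potential in the coordinates of the chart \<open>c\<close>. The sum is real because the
  metric is Hermitian.\<close>

definition scalar_potential ::
    "('a, 'n::finite) chart \<Rightarrow> ('a, 'n) metric \<Rightarrow> ('a \<Rightarrow> complex) \<Rightarrow> complex^'n \<Rightarrow> real" where
  "scalar_potential c g W z =
     Re (\<Sum>i\<in>UNIV. \<Sum>j\<in>UNIV. inverse_metric (g c z) $ i $ j *
           wirtinger i (\<lambda>w. W (inv_into (fst c) (snd c) w)) z *
           wirtinger_bar j (\<lambda>w. cnj (W (inv_into (fst c) (snd c) w))) z)"

definition supersymmetric_vacuum ::
    "('a, 'n::finite) chart \<Rightarrow> ('a \<Rightarrow> complex) \<Rightarrow> 'a \<Rightarrow> bool" where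
  "supersymmetric_vacuum c W p \<longleftrightarrow>
     (\<forall>i. wirtinger i (\<lambda>w. W (inv_into (fst c) (snd c) w)) (snd c p) = 0)"

section \<open>Hessian and Morse index\<close>

text \<open>With \<open>z\<^sup>i = x\<^sup>i + \<i> y\<^sup>i\<close>, the index \<open>Inl i\<close> stands for \<open>x\<^sup>i\<close> and \<open>Inr i\<close> for \<open>y\<^sup>i\<close>.\<close>

definition real_axis :: "'n::finite + 'n \<Rightarrow> complex^'n" where
  "real_axis a = (case a of Inl i \<Rightarrow> axis i 1 | Inr i \<Rightarrow> axis i \<i>)"

definition hessian :: "(complex^'n::finite \<Rightarrow> real) \<Rightarrow> complex^'n \<Rightarrow> real^('n + 'n)^('n + 'n)" where
  "hessian f z =
     (\<chi> a b. partial_derivative (real_axis a) (partial_derivative (real_axis b) f) z)"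

definition nondegenerate_critical_point :: "(complex^'n::finite \<Rightarrow> real) \<Rightarrow> complex^'n \<Rightarrow> bool" where
  "nondegenerate_critical_point f z \<longleftrightarrow>
     (\<forall>a. partial_derivative (real_axis a) f z = 0) \<and> invertible (hessian f z)"

definition eigenspace :: "real^'k^'k::finite \<Rightarrow> real \<Rightarrow> (real^'k) set" where
  "eigenspace H e = {v. H *v v = e *\<^sub>R v}"

text \<open>The number of negative eigenvalues, counted with multiplicity.\<close>

definition negative_eigenvalue_count :: "real^'k^'k::finite \<Rightarrow> nat" where
  "negative_eigenvalue_count H =
     (\<Sum>e | e < 0 \<and> eigenspace H e \<noteq> {0}. dim (eigenspace H e))"

definition morse_index :: "(complex^'n::finite \<Rightarrow> real) \<Rightarrow> complex^'n \<Rightarrow> nat" where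
  "morse_index f z = negative_eigenvalue_count (hessian f z)"

end

theory Submission
  imports Defs "HOL-Complex_Analysis.Cauchy_Integral_Formula"
begin

text \<open>For \<open>\<tau> \<noteq> 1 / (2 \<Lambda>)\<close> the potential is \<open>V(\<tau>) = f / \<sigma>(\<tau>)\<close> near the vacuum, with \<open>f\<close> independent of
  \<open>\<tau>\<close>, so the Hessian only changes by the factor \<open>1 / \<sigma>(\<tau>)\<close>, whose sign flips at the singular time.
  For the coordinates, no Taylor expansion is needed: \<open>f = u \<bullet> Q u\<close>, where \<open>u\<close> collects the real and
  imaginary parts of the \<open>\<partial>\<^sub>i W\<close> and vanishes at the vacuum, and \<open>Q\<close> is a smooth symmetric matrix made
  from the inverse metric. The Hessian is \<open>2 B\<^sup>T Q B\<close> with \<open>B\<close> the Jacobian matrix of \<open>u\<close>; its invertibility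
  makes \<open>u\<close> a coordinate system. A smooth matrix square root gives \<open>Q = P\<^sup>T diag(\<plusminus>1) P\<close>
  near the vacuum with \<open>P\<close> smooth, and \<open>X = P u\<close> are the coordinates sought.\<close>

section \<open>Smooth functions and the smooth inverse function theorem\<close>

text \<open>The usual proof of the Morse lemma obtains a quadratic form with smooth coefficients
  from a Taylor remainder. Here the potential is such a form from the start, in the gradient of W.
  As neither \<open>u\<close> nor \<open>Q\<close> contains \<tau>, one neighbourhood, one sign
  pattern and one system of coordinates serve all times; |\<sigma>| is absorbed by the factor
  |\<sigma>|^(-1/2) of the coordinates and the sign of \<sigma> stays in front. Two analytic
  obstacles shape the rest. The square root and the coordinates both need local inverses that are
  differentiable to every order; these come from the C^1 theorem by a bootstrap, for which inversion
  of linear maps must preserve each order. And W is only given a complex linear Frechet derivative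
  at each point, so even continuity of that derivative has to be proved; Cauchy's formula on circles
  in complex lines yields it, and then all higher orders.\<close>

lemma partial_derivative_eq:
  assumes "(f has_derivative D) (at x)"
  shows "partial_derivative v f x = D v"
proof -
  have "((\<lambda>t. x + t *\<^sub>R v) has_derivative (\<lambda>t. t *\<^sub>R v)) (at 0)"
    by (auto intro!: derivative_eq_intros)
  then have "((\<lambda>t. f (x + t *\<^sub>R v)) has_derivative (\<lambda>t. D (t *\<^sub>R v))) (at 0)"
    using has_derivative_compose[of "\<lambda>t. x + t *\<^sub>R v" _ 0 UNIV f D] assms by simp
  then have "((\<lambda>t. f (x + t *\<^sub>R v)) has_vector_derivative D v) (at 0)"
    using has_derivative_linear[OF assms] by (simp add: has_vector_derivative_def linear_scale)
  then show ?thesis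
    unfolding partial_derivative_def by (rule vector_derivative_at)
qed

lemma partial_derivative_cong:
  assumes "open S" "x \<in> S" "\<And>y. y \<in> S \<Longrightarrow> f y = g y"
  shows "partial_derivative v f x = partial_derivative v g x"
proof -
  have "((\<lambda>t. x + t *\<^sub>R v) \<longlongrightarrow> x + 0 *\<^sub>R v) (at 0)"
    by (intro tendsto_intros)
  then have "\<forall>\<^sub>F t in at 0. x + t *\<^sub>R v \<in> S"
    using assms by (intro topological_tendstoD) auto
  then have "\<forall>\<^sub>F t in nhds 0. x + t *\<^sub>R v \<in> S"
    using assms by (simp add: eventually_nhds_conv_at)
  then have "\<forall>\<^sub>F t in nhds 0. f (x + t *\<^sub>R v) = g (x + t *\<^sub>R v)"
    by eventually_elim (use assms in auto)
  then show ?thesis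
    unfolding partial_derivative_def
    by (auto intro!: vector_derivative_cong_eq elim: eventually_mono)
qed

section \<open>Calculus of functions differentiable to a finite order\<close>

lemma k_times_differentiable_on_cong:
  assumes "open S" "\<And>x. x \<in> S \<Longrightarrow> f x = g x"
  shows "k_times_differentiable_on k f S \<longleftrightarrow> k_times_differentiable_on k g S"
  using assms
proof (induction k arbitrary: f g)
  case 0
  then show ?case by (auto intro!: continuous_on_cong)
next
  case (Suc k)
  have "f differentiable_on S \<longleftrightarrow> g differentiable_on S"
    unfolding differentiable_on_def differentiable_def
    using Suc.prems(2) has_derivative_transform[of _ S f g] has_derivative_transform[of _ S g f]
    by (intro ball_cong refl iffI; metis)
  moreover have "k_times_differentiable_on k (partial_derivative v f) S \<longleftrightarrow>
      k_times_differentiable_on k (partial_derivative v g) S" for v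
    by (rule Suc.IH[OF Suc.prems(1)]) (rule partial_derivative_cong[OF Suc.prems(1)], use Suc.prems in auto)
  ultimately show ?case by simp
qed

lemma k_times_differentiable_on_transform:
  "open S \<Longrightarrow> k_times_differentiable_on k f S \<Longrightarrow> (\<And>x. x \<in> S \<Longrightarrow> f x = g x)
    \<Longrightarrow> k_times_differentiable_on k g S"
  using k_times_differentiable_on_cong by blast

text \<open>A derivative \<open>D\<close> given by a formula is easier to handle than iterated
  \<open>partial_derivative\<close> terms. With this rule and its converse, each closure property is
  an induction on k, general in the functions: differentiate once by the known rule and apply the
  hypothesis to the result.\<close>

lemma k_times_differentiable_on_SucI:
  assumes "open S" "\<And>x. x \<in> S \<Longrightarrow> (f has_derivative D x) (at x)"
    "\<And>b. b \<in> Basis \<Longrightarrow> k_times_differentiable_on k (\<lambda>x. D x b) S"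
  shows "k_times_differentiable_on (Suc k) f S"
proof -
  have "k_times_differentiable_on k (partial_derivative b f) S" if "b \<in> Basis" for b
    by (rule k_times_differentiable_on_transform[OF assms(1) assms(3)[OF that]])
      (simp add: partial_derivative_eq[OF assms(2)])
  moreover have "f differentiable_on S"
    using assms(2) by (meson differentiable_at_imp_differentiable_on differentiable_def)
  ultimately show ?thesis by simp
qed

lemma k_times_differentiable_on_SucE:
  assumes "open S" "k_times_differentiable_on (Suc k) f S"
  obtains D where "\<And>x. x \<in> S \<Longrightarrow> (f has_derivative D x) (at x)"
    "\<And>b. b \<in> Basis \<Longrightarrow> k_times_differentiable_on k (\<lambda>x. D x b) S"
proof
  show *: "(f has_derivative frechet_derivative f (at x)) (at x)" if "x \<in> S" for x
    using assms that differentiable_on_eq_differentiable_at frechet_derivative_works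
    by (metis k_times_differentiable_on.simps(2))
  show "k_times_differentiable_on k (\<lambda>x. frechet_derivative f (at x) b) S" if "b \<in> Basis" for b
    by (rule k_times_differentiable_on_transform[OF assms(1), of _ "partial_derivative b f"])
      (use assms(2) that partial_derivative_eq[OF *] in auto)
qed

text \<open>The recursion says nothing about lower orders of \<open>f\<close> itself, so lowering
  the order takes an induction; it bottoms out where differentiability implies continuity.\<close>

lemma k_times_differentiable_on_SucD:
  "open S \<Longrightarrow> k_times_differentiable_on (Suc k) f S \<Longrightarrow> k_times_differentiable_on k f S"
proof (induction k arbitrary: f)
  case 0
  then show ?case by (auto intro: differentiable_imp_continuous_on)
next
  case (Suc k)
  then show ?case by auto
qed

lemma k_times_differentiable_on_subset:
  "k_times_differentiable_on k f S \<Longrightarrow> T \<subseteq> S \<Longrightarrow> k_times_differentiable_on k f T"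
  by (induction k arbitrary: f)
    (auto intro: continuous_on_subset differentiable_on_subset)

lemma k_times_differentiable_on_const:
  "open S \<Longrightarrow> k_times_differentiable_on k (\<lambda>x. c) S"
proof (induction k arbitrary: c)
  case (Suc k)
  show ?case
    by (rule k_times_differentiable_on_SucI[where D = "\<lambda>x h. 0"]) (use Suc in auto)
qed auto

lemma k_times_differentiable_on_linear:
  assumes "open S" "bounded_linear f"
  shows "k_times_differentiable_on k f S"
proof (cases k)
  case 0
  then show ?thesis
    using assms linear_continuous_on by auto
next
  case (Suc m)
  show ?thesis
    unfolding Suc
    by (rule k_times_differentiable_on_SucI[where D = "\<lambda>x. f"])
      (use assms k_times_differentiable_on_const bounded_linear_imp_has_derivative in auto)
qed

lemma k_times_differentiable_on_linear_compose:
  assumes "open S" "bounded_linear L" "k_times_differentiable_on k f S"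
  shows "k_times_differentiable_on k (\<lambda>x. L (f x)) S"
  using assms(3)
proof (induction k arbitrary: f)
  case 0
  then show ?case
    using assms(2) by (auto intro: bounded_linear.continuous_on)
next
  case (Suc k)
  from k_times_differentiable_on_SucE[OF assms(1) Suc.prems] obtain D where
    D: "\<And>x. x \<in> S \<Longrightarrow> (f has_derivative D x) (at x)"
    "\<And>b. b \<in> Basis \<Longrightarrow> k_times_differentiable_on k (\<lambda>x. D x b) S" by blast
  show ?case
    by (rule k_times_differentiable_on_SucI[OF assms(1) bounded_linear.has_derivative[OF assms(2) D(1)]])
      (auto intro: D Suc.IH)
qed

lemma k_times_differentiable_on_add:
  assumes "open S" "k_times_differentiable_on k f S" "k_times_differentiable_on k g S"
  shows "k_times_differentiable_on k (\<lambda>x. f x + g x) S"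
  using assms(2,3)
proof (induction k arbitrary: f g)
  case 0
  then show ?case by (auto intro: continuous_on_add)
next
  case (Suc k)
  from k_times_differentiable_on_SucE[OF assms(1) Suc.prems(1)] obtain D where
    D: "\<And>x. x \<in> S \<Longrightarrow> (f has_derivative D x) (at x)"
    "\<And>b. b \<in> Basis \<Longrightarrow> k_times_differentiable_on k (\<lambda>x. D x b) S" by blast
  from k_times_differentiable_on_SucE[OF assms(1) Suc.prems(2)] obtain E where
    E: "\<And>x. x \<in> S \<Longrightarrow> (g has_derivative E x) (at x)"
    "\<And>b. b \<in> Basis \<Longrightarrow> k_times_differentiable_on k (\<lambda>x. E x b) S" by blast
  show ?case
    by (rule k_times_differentiable_on_SucI[where D = "\<lambda>x h. D x h + E x h"])
      (use assms(1) D E Suc.IH in \<open>auto intro: has_derivative_add\<close>)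
qed

lemma k_times_differentiable_on_sum:
  assumes "open S" "\<And>i. i \<in> I \<Longrightarrow> k_times_differentiable_on k (f i) S"
  shows "k_times_differentiable_on k (\<lambda>x. \<Sum>i\<in>I. f i x) S"
proof (cases "finite I")
  case True
  then show ?thesis
    using assms(2)
    by (induction I)
      (auto intro: k_times_differentiable_on_const k_times_differentiable_on_add assms(1))
qed (auto intro: k_times_differentiable_on_const assms(1))

lemma k_times_differentiable_on_bilinear:
  assumes "open S" "bounded_bilinear m"
    "k_times_differentiable_on k f S" "k_times_differentiable_on k g S"
  shows "k_times_differentiable_on k (\<lambda>x. m (f x) (g x)) S"
  using assms(3,4)
proof (induction k arbitrary: f g)
  case 0
  then show ?case
    using bounded_bilinear.continuous_on[OF assms(2)] by auto
next
  case (Suc k)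
  note fg = Suc.prems[THEN k_times_differentiable_on_SucD[OF assms(1)]]
  from k_times_differentiable_on_SucE[OF assms(1) Suc.prems(1)] obtain D where
    D: "\<And>x. x \<in> S \<Longrightarrow> (f has_derivative D x) (at x)"
    "\<And>b. b \<in> Basis \<Longrightarrow> k_times_differentiable_on k (\<lambda>x. D x b) S" by blast
  from k_times_differentiable_on_SucE[OF assms(1) Suc.prems(2)] obtain E where
    E: "\<And>x. x \<in> S \<Longrightarrow> (g has_derivative E x) (at x)"
    "\<And>b. b \<in> Basis \<Longrightarrow> k_times_differentiable_on k (\<lambda>x. E x b) S" by blast
  show ?case
    by (rule k_times_differentiable_on_SucI[where D = "\<lambda>x h. m (f x) (E x h) + m (D x h) (g x)"])
      (use assms(1) D E fg Suc.IH in
        \<open>auto intro: bounded_bilinear.FDERIV[OF assms(2)] k_times_differentiable_on_add\<close>)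
qed

lemma k_times_differentiable_on_compose:
  fixes h :: "'u::euclidean_space \<Rightarrow> 'v::euclidean_space"
  assumes "open S" "open T" "h ` S \<subseteq> T"
    "k_times_differentiable_on k f T" "k_times_differentiable_on k h S"
  shows "k_times_differentiable_on k (\<lambda>x. f (h x)) S"
  using assms(4,5)
proof (induction k arbitrary: f)
  case 0
  then show ?case
    using assms(3) by (auto intro: continuous_on_compose2)
next
  case (Suc k)
  note h = Suc.prems(2)[THEN k_times_differentiable_on_SucD[OF assms(1)]]
  from k_times_differentiable_on_SucE[OF assms(2) Suc.prems(1)] obtain D where
    D: "\<And>x. x \<in> T \<Longrightarrow> (f has_derivative D x) (at x)"
    "\<And>b. b \<in> Basis \<Longrightarrow> k_times_differentiable_on k (\<lambda>x. D x b) T" by blast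
  from k_times_differentiable_on_SucE[OF assms(1) Suc.prems(2)] obtain E where
    E: "\<And>x. x \<in> S \<Longrightarrow> (h has_derivative E x) (at x)"
    "\<And>b. b \<in> Basis \<Longrightarrow> k_times_differentiable_on k (\<lambda>x. E x b) S" by blast
  \<comment> \<open>The regularity of \<open>D\<close> is known only along fixed basis vectors,
    while the chain rule evaluates it at the moving vector \<open>E x b\<close>. Expanding that
    vector leaves products of functions of known order.\<close>
  have *: "D (h x) (E x b) = (\<Sum>c\<in>Basis. (E x b \<bullet> c) *\<^sub>R D (h x) c)" if "x \<in> S" for x b
  proof -
    have "linear (D (h x))"
      using D(1)[of "h x"] that assms(3) has_derivative_linear by blast
    then have "D (h x) (\<Sum>c\<in>Basis. (E x b \<bullet> c) *\<^sub>R c) = (\<Sum>c\<in>Basis. (E x b \<bullet> c) *\<^sub>R D (h x) c)"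
      by (simp add: linear_sum linear_scale)
    then show ?thesis
      by (simp add: euclidean_representation)
  qed
  show ?case
  proof (rule k_times_differentiable_on_SucI[where D = "\<lambda>x b. D (h x) (E x b)"])
    show "((\<lambda>x. f (h x)) has_derivative (\<lambda>b. D (h x) (E x b))) (at x)" if "x \<in> S" for x
      using has_derivative_compose[OF E(1)[OF that] D(1)[of "h x"]] that assms(3) by auto
    fix b :: 'u assume b: "b \<in> Basis"
    have "k_times_differentiable_on k (\<lambda>x. \<Sum>c\<in>Basis. (E x b \<bullet> c) *\<^sub>R D (h x) c) S"
      by (intro k_times_differentiable_on_sum k_times_differentiable_on_bilinear[OF _ bounded_bilinear_scaleR]
          k_times_differentiable_on_linear_compose[OF _ bounded_linear_inner_left] assms(1) E(2) b
          Suc.IH[OF D(2) h])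
    then show "k_times_differentiable_on k (\<lambda>x. D (h x) (E x b)) S"
      by (rule k_times_differentiable_on_transform[OF assms(1)]) (simp add: *)
  qed (rule assms)
qed

text \<open>A product rule in which \<open>B\<close> is merely continuous: freezing \<open>B\<close>
  at \<open>x\<close> costs \<open>m (B y - B x) (C y)\<close>, and this is o(1) times O(|y - x|)
  because \<open>C\<close> is differentiable and vanishes at \<open>x\<close>. It differentiates an
  inverse before the inverse is known to be differentiable.\<close>

lemma has_derivative_bilinear_vanishing:
  assumes m: "bounded_bilinear m" and B: "isCont B x"
    and C: "(C has_derivative D) (at x)" "C x = 0"
  shows "((\<lambda>y. m (B y) (C y)) has_derivative (\<lambda>h. m (B x) (D h))) (at x)"
proof -
  interpret m: bounded_bilinear m by (rule m)
  have 1: "((\<lambda>y. m (B x) (C y)) has_derivative (\<lambda>h. m (B x) (D h))) (at x)"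
    by (rule bounded_linear.has_derivative[OF m.bounded_linear_right C(1)])
  obtain K where K: "K > 0" "\<And>a b. norm (m a b) \<le> norm a * norm b * K"
    using m.pos_bounded by blast
  obtain L where L: "L > 0" "\<And>h. norm (D h) \<le> norm h * L"
    using bounded_linear.pos_bounded[OF has_derivative_bounded_linear[OF C(1)]] by blast
  have 2: "((\<lambda>y. m (B y - B x) (C y)) has_derivative (\<lambda>h. 0)) (at x)"
    unfolding has_derivative_iff_norm
  proof (intro conjI)
    \<comment> \<open>\<open>?q\<close> is the remainder quotient of \<open>C\<close>. Since
      \<open>C x = 0\<close>, the norm of \<open>C y\<close> is at most \<open>?q y + L\<close>
      times the distance from y to x, where L bounds \<open>D\<close>.\<close>
    let ?q = "\<lambda>y. norm (C y - C x - D (y - x)) / norm (y - x)"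
    have "(?q \<longlongrightarrow> 0) (at x)"
      using C(1) unfolding has_derivative_iff_norm by auto
    moreover have "((\<lambda>y. norm (B y - B x)) \<longlongrightarrow> 0) (at x)"
      using B by (simp add: isCont_def LIM_zero tendsto_norm_zero)
    ultimately have "((\<lambda>y. norm (B y - B x) * (?q y + L) * K) \<longlongrightarrow> 0 * (0 + L) * K) (at x)"
      by (intro tendsto_intros)
    then have lim: "((\<lambda>y. norm (B y - B x) * (?q y + L) * K) \<longlongrightarrow> 0) (at x)" by simp
    show "((\<lambda>y. norm (m (B y - B x) (C y) - m (B x - B x) (C x) - 0) / norm (y - x)) \<longlongrightarrow> 0) (at x)"
    proof (rule Lim_null_comparison[OF _ lim])
      show "\<forall>\<^sub>F y in at x. norm (norm (m (B y - B x) (C y) - m (B x - B x) (C x) - 0) / norm (y - x))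
          \<le> norm (B y - B x) * (?q y + L) * K"
        using eventually_neq_at_within[of x x UNIV]
      proof eventually_elim
      case (elim y)
      then have n: "norm (y - x) > 0" by simp
      have "norm (C y) \<le> norm (C y - C x - D (y - x)) + norm (D (y - x))"
        using norm_triangle_ineq[of "C y - C x - D (y - x)" "D (y - x)"] C(2) by simp
      also have "\<dots> \<le> norm (C y - C x - D (y - x)) + norm (y - x) * L"
        using L(2) by simp
      also have "\<dots> = (?q y + L) * norm (y - x)"
        using n by (simp add: field_simps)
      finally have c: "norm (C y) \<le> (?q y + L) * norm (y - x)" .
      have "norm (m (B y - B x) (C y)) \<le> norm (B y - B x) * norm (C y) * K"
        by (rule K)
      also have "\<dots> \<le> norm (B y - B x) * ((?q y + L) * norm (y - x)) * K"
        using c K(1) by (intro mult_right_mono mult_left_mono) auto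
      finally have "norm (m (B y - B x) (C y)) / norm (y - x) \<le> norm (B y - B x) * (?q y + L) * K"
        using n by (simp add: divide_le_eq mult_ac)
      then show ?case
        by (simp add: m.zero_left)
      qed
    qed
  qed auto
  have "(\<lambda>y. m (B y) (C y)) = (\<lambda>y. m (B y - B x) (C y) + m (B x) (C y))"
    by (simp add: m.add_left[symmetric])
  then show ?thesis
    using has_derivative_add[OF 2 1] by simp
qed

text \<open>The product \<open>m\<close> is a parameter so that the results below cover matrices as well as the
  composition of bounded linear maps.\<close>

lemma isCont_bilinear_inverse:
  assumes m: "bounded_bilinear m" and assoc: "\<And>a b c. m (m a b) c = m a (m b c)"
    and unit: "\<And>a. m e a = a" "\<And>a. m a e = a"
    and "open S" "x \<in> S" and A: "isCont A x"
    and inv: "\<And>y. y \<in> S \<Longrightarrow> m (A y) (B y) = e" "\<And>y. y \<in> S \<Longrightarrow> m (B y) (A y) = e"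
  shows "isCont B x"
    and "\<And>y. y \<in> S \<Longrightarrow> B y = B x - m (B y) (m (A y - A x) (B x))"
proof -
  interpret m: bounded_bilinear m by (rule m)
  obtain K where K: "K > 0" "\<And>a b. norm (m a b) \<le> norm a * norm b * K"
    using m.pos_bounded by blast
  \<comment> \<open>The resolvent identity. It is the source of the continuity proved here and of
    the derivative formula below.\<close>
  show diff: "B y = B x - m (B y) (m (A y - A x) (B x))" if "y \<in> S" for y
  proof -
    have "m (m (B y) (A y)) (B x) = B x" "m (B y) (m (A x) (B x)) = B y"
      using inv[OF that] inv[OF \<open>x \<in> S\<close>] by (simp_all add: unit)
    then show ?thesis
      by (simp add: m.diff_left m.diff_right assoc)
  qed
  have ev: "\<forall>\<^sub>F y in at x. y \<in> S"
    using assms(5,6) by (rule eventually_at_in_open')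
  have diff_le: "norm (B y - B x) \<le> norm (B y) * (norm (A y - A x) * norm (B x) * K * K)"
    if "y \<in> S" for y
  proof -
    have "B y - B x = - m (B y) (m (A y - A x) (B x))"
      using diff[OF that] by (metis diff_add_cancel minus_diff_eq add_diff_cancel_left' uminus_add_conv_diff)
    then have "norm (B y - B x) \<le> norm (B y) * norm (m (A y - A x) (B x)) * K"
      using K(2)[of "B y" "m (A y - A x) (B x)"] by simp
    also have "\<dots> \<le> norm (B y) * (norm (A y - A x) * norm (B x) * K) * K"
      using K by (intro mult_right_mono mult_left_mono) auto
    finally show ?thesis by (simp add: mult_ac)
  qed
  have A_lim: "((\<lambda>y. norm (A y - A x) * norm (B x) * K * K) \<longlongrightarrow> 0) (at x)"
  proof -
    have "(A \<longlongrightarrow> A x) (at x)"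
      using A by (simp add: isCont_def)
    then have "((\<lambda>y. norm (A y - A x) * norm (B x) * K * K) \<longlongrightarrow> 0 * norm (B x) * K * K) (at x)"
      by (intro tendsto_mult_right tendsto_norm_zero LIM_zero)
    then show ?thesis by simp
  qed
  \<comment> \<open>No bound on \<open>B\<close> near \<open>x\<close> is available yet. Once the
    factor of \<open>norm (B y)\<close> in \<open>diff_le\<close> is below 1/2, that term can be
    absorbed on the left, which bounds \<open>norm (B y)\<close> by twice
    \<open>norm (B x)\<close>.\<close>
  have "\<forall>\<^sub>F y in at x. norm (A y - A x) * norm (B x) * K * K < 1/2"
    using order_tendstoD(2)[OF A_lim, of "1/2"] by simp
  then have bd: "\<forall>\<^sub>F y in at x. norm (B y) \<le> 2 * norm (B x)"
    using ev
  proof eventually_elim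
    case (elim y)
    have "norm (B y) - norm (B x) \<le> norm (B y - B x)"
      by (rule norm_triangle_ineq2)
    also have "\<dots> \<le> norm (B y) * (norm (A y - A x) * norm (B x) * K * K)"
      using diff_le elim by blast
    also have "\<dots> \<le> norm (B y) * (1/2)"
      using elim by (intro mult_left_mono) auto
    finally show ?case by simp
  qed
  have "((\<lambda>y. B y - B x) \<longlongrightarrow> 0) (at x)"
  proof (rule Lim_null_comparison)
    show "\<forall>\<^sub>F y in at x. norm (B y - B x) \<le> 2 * norm (B x) * (norm (A y - A x) * norm (B x) * K * K)"
      using bd ev
    proof eventually_elim
      case (elim y)
      have "norm (B y) * (norm (A y - A x) * norm (B x) * K * K) \<le>
          2 * norm (B x) * (norm (A y - A x) * norm (B x) * K * K)"
        using elim K(1) by (intro mult_right_mono) auto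
      then show ?case
        using diff_le[OF elim(2)] by linarith
    qed
    show "((\<lambda>y. 2 * norm (B x) * (norm (A y - A x) * norm (B x) * K * K)) \<longlongrightarrow> 0) (at x)"
      by (rule tendsto_mult_right_zero[OF A_lim])
  qed
  then show "isCont B x"
    by (simp add: isCont_def LIM_zero_iff)
qed

text \<open>The resolvent identity writes \<open>B\<close> as a constant minus a product whose
  second factor vanishes at \<open>x\<close>, so continuity of \<open>B\<close> is enough to
  differentiate it.\<close>

lemma has_derivative_bilinear_inverse:
  assumes m: "bounded_bilinear m" and assoc: "\<And>a b c. m (m a b) c = m a (m b c)"
    and unit: "\<And>a. m e a = a" "\<And>a. m a e = a"
    and "open S" "x \<in> S" and A: "(A has_derivative D) (at x)"
    and inv: "\<And>y. y \<in> S \<Longrightarrow> m (A y) (B y) = e" "\<And>y. y \<in> S \<Longrightarrow> m (B y) (A y) = e"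
  shows "(B has_derivative (\<lambda>h. - m (B x) (m (D h) (B x)))) (at x)"
proof -
  interpret m: bounded_bilinear m by (rule m)
  note B = isCont_bilinear_inverse[OF m assoc unit \<open>open S\<close> \<open>x \<in> S\<close> has_derivative_continuous[OF A] inv]
  have "((\<lambda>y. m (A y - A x) (B x)) has_derivative (\<lambda>h. m (D h) (B x))) (at x)"
    using bounded_linear.has_derivative[OF m.bounded_linear_left has_derivative_diff[OF A has_derivative_const]]
    by simp
  from has_derivative_bilinear_vanishing[OF m B(1) this]
  have "((\<lambda>y. m (B y) (m (A y - A x) (B x))) has_derivative (\<lambda>h. m (B x) (m (D h) (B x)))) (at x)"
    by (simp add: m.zero_left)
  then have "((\<lambda>y. B x - m (B y) (m (A y - A x) (B x))) has_derivative (\<lambda>h. - m (B x) (m (D h) (B x)))) (at x)"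
    using has_derivative_diff[OF has_derivative_const[of "B x"]] by fastforce
  then show ?thesis
    by (rule has_derivative_transform_within_open[OF _ assms(5,6)]) (rule B(2)[symmetric])
qed

text \<open>The derivative of \<open>B\<close> is a product of copies of \<open>B\<close> and the
  derivative of \<open>A\<close>. If \<open>A\<close> has order k + 1 and \<open>B\<close> has order
  k, this product has order k, so \<open>B\<close> gains one order.\<close>

lemma k_times_differentiable_on_bilinear_inverse:
  assumes m: "bounded_bilinear m" and assoc: "\<And>a b c. m (m a b) c = m a (m b c)"
    and unit: "\<And>a. m e a = a" "\<And>a. m a e = a"
    and "open S" and A: "k_times_differentiable_on k A S"
    and inv: "\<And>y. y \<in> S \<Longrightarrow> m (A y) (B y) = e" "\<And>y. y \<in> S \<Longrightarrow> m (B y) (A y) = e"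
  shows "k_times_differentiable_on k B S"
  using A
proof (induction k)
  case 0
  then have "isCont A x" if "x \<in> S" for x
    using that \<open>open S\<close> continuous_on_eq_continuous_at by auto
  then have "isCont B x" if "x \<in> S" for x
    by (rule isCont_bilinear_inverse(1)[OF m assoc unit \<open>open S\<close> that _ inv]) (use that in auto)
  then show ?case
    by (auto intro: continuous_at_imp_continuous_on)
next
  case (Suc k)
  from k_times_differentiable_on_SucE[OF assms(5) Suc.prems] obtain D where
    D: "\<And>x. x \<in> S \<Longrightarrow> (A has_derivative D x) (at x)"
    "\<And>b. b \<in> Basis \<Longrightarrow> k_times_differentiable_on k (\<lambda>x. D x b) S" by blast
  have B: "k_times_differentiable_on k B S"
    using Suc k_times_differentiable_on_SucD[OF \<open>open S\<close>] by blast
  show ?case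
    by (rule k_times_differentiable_on_SucI[OF \<open>open S\<close>
          has_derivative_bilinear_inverse[OF m assoc unit \<open>open S\<close> _ D(1) inv]])
      (auto intro!: k_times_differentiable_on_bilinear[OF \<open>open S\<close> m] D(2) B
        k_times_differentiable_on_linear_compose[OF \<open>open S\<close> bounded_linear_minus[OF bounded_linear_ident]])
qed

section \<open>Closure rules for smooth functions\<close>

lemma smooth_on_transform:
  "open S \<Longrightarrow> smooth_on f S \<Longrightarrow> (\<And>x. x \<in> S \<Longrightarrow> f x = g x) \<Longrightarrow> smooth_on g S"
  using k_times_differentiable_on_transform unfolding smooth_on_def by blast

lemma smooth_on_subset: "smooth_on f S \<Longrightarrow> T \<subseteq> S \<Longrightarrow> smooth_on f T"
  using k_times_differentiable_on_subset unfolding smooth_on_def by blast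

lemma smooth_on_const: "open S \<Longrightarrow> smooth_on (\<lambda>x. c) S"
  by (simp add: smooth_on_def k_times_differentiable_on_const)

lemma smooth_on_linear: "open S \<Longrightarrow> bounded_linear f \<Longrightarrow> smooth_on f S"
  by (simp add: smooth_on_def k_times_differentiable_on_linear)

lemma smooth_on_linear_compose:
  "open S \<Longrightarrow> bounded_linear L \<Longrightarrow> smooth_on f S \<Longrightarrow> smooth_on (\<lambda>x. L (f x)) S"
  by (simp add: smooth_on_def k_times_differentiable_on_linear_compose)

lemma smooth_on_add:
  "open S \<Longrightarrow> smooth_on f S \<Longrightarrow> smooth_on g S \<Longrightarrow> smooth_on (\<lambda>x. f x + g x) S"
  by (simp add: smooth_on_def k_times_differentiable_on_add)

lemma smooth_on_sum:
  "open S \<Longrightarrow> (\<And>i. i \<in> I \<Longrightarrow> smooth_on (f i) S) \<Longrightarrow> smooth_on (\<lambda>x. \<Sum>i\<in>I. f i x) S"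
  by (simp add: smooth_on_def k_times_differentiable_on_sum)

lemma smooth_on_bilinear:
  "open S \<Longrightarrow> bounded_bilinear m \<Longrightarrow> smooth_on f S \<Longrightarrow> smooth_on g S
    \<Longrightarrow> smooth_on (\<lambda>x. m (f x) (g x)) S"
  by (simp add: smooth_on_def k_times_differentiable_on_bilinear)

lemma smooth_on_compose:
  "open S \<Longrightarrow> open T \<Longrightarrow> h ` S \<subseteq> T \<Longrightarrow> smooth_on f T \<Longrightarrow> smooth_on h S
    \<Longrightarrow> smooth_on (\<lambda>x. f (h x)) S"
  unfolding smooth_on_def using k_times_differentiable_on_compose by blast

lemma smooth_on_continuous_on: "smooth_on f S \<Longrightarrow> continuous_on S f"
  unfolding smooth_on_def by (metis k_times_differentiable_on.simps(1))

text \<open>The definition controls basis directions only; linearity of the derivative extends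
  smoothness to every fixed direction v.\<close>

lemma smooth_onE:
  assumes "open S" "smooth_on f S"
  obtains D where "\<And>x. x \<in> S \<Longrightarrow> (f has_derivative D x) (at x)"
    "\<And>v. smooth_on (\<lambda>x. D x v) S"
proof -
  define D where "D = (\<lambda>x. frechet_derivative f (at x))"
  have D: "(f has_derivative D x) (at x)" if "x \<in> S" for x
    using assms that unfolding smooth_on_def D_def
    by (metis differentiable_on_eq_differentiable_at frechet_derivative_works
        k_times_differentiable_on.simps(2))
  have B: "smooth_on (\<lambda>x. D x b) S" if "b \<in> Basis" for b
  proof (rule smooth_on_transform[OF assms(1), of "partial_derivative b f"])
    show "smooth_on (partial_derivative b f) S"
      using assms(2) that unfolding smooth_on_def by (metis k_times_differentiable_on.simps(2))
  qed (simp add: partial_derivative_eq[OF D])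
  have "smooth_on (\<lambda>x. D x v) S" for v
  proof (rule smooth_on_transform[OF assms(1)])
    show "smooth_on (\<lambda>x. \<Sum>b\<in>Basis. (v \<bullet> b) *\<^sub>R D x b) S"
      by (intro smooth_on_sum smooth_on_linear_compose[OF _ bounded_linear_scaleR_right] assms(1) B)
    fix x assume "x \<in> S"
    then have "linear (D x)"
      using D has_derivative_linear by blast
    then have "D x (\<Sum>b\<in>Basis. (v \<bullet> b) *\<^sub>R b) = (\<Sum>b\<in>Basis. (v \<bullet> b) *\<^sub>R D x b)"
      by (simp add: linear_sum linear_scale)
    then show "(\<Sum>b\<in>Basis. (v \<bullet> b) *\<^sub>R D x b) = D x v"
      by (simp add: euclidean_representation)
  qed
  with D show ?thesis using that by blast
qed

lemma smooth_on_partial_derivative: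
  assumes "open S" "smooth_on f S"
  shows "smooth_on (partial_derivative v f) S"
proof (rule smooth_onE[OF assms])
  fix D assume D: "\<And>x. x \<in> S \<Longrightarrow> (f has_derivative D x) (at x)" "\<And>v. smooth_on (\<lambda>x. D x v) S"
  show ?thesis
    by (rule smooth_on_transform[OF assms(1) D(2)]) (simp add: partial_derivative_eq[OF D(1)])
qed

lemma smooth_on_bilinear_inverse:
  assumes "bounded_bilinear m" "\<And>a b c. m (m a b) c = m a (m b c)"
    "\<And>a. m e a = a" "\<And>a. m a e = a" "open S" "smooth_on A S"
    "\<And>y. y \<in> S \<Longrightarrow> m (A y) (B y) = e" "\<And>y. y \<in> S \<Longrightarrow> m (B y) (A y) = e"
  shows "smooth_on B S"
  using assms(6) unfolding smooth_on_def
  by (intro allI k_times_differentiable_on_bilinear_inverse[OF assms(1-5) _ assms(7,8)]) blast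

text \<open>The inverse function theorem and the inversion lemma, applied to composition, work with
  one map into the normed space of bounded linear maps. Regularity is stated for each k separately
  because k = 0 is used for holomorphic functions, before more is known about them.\<close>

lemma blinfun_of_derivative:
  fixes f :: "'v::euclidean_space \<Rightarrow> 'w::real_normed_vector"
  assumes "open S" and D: "\<And>x. x \<in> S \<Longrightarrow> (f has_derivative D x) (at x)"
  obtains F :: "'v \<Rightarrow> 'v \<Rightarrow>\<^sub>L 'w" where
    "\<And>x. x \<in> S \<Longrightarrow> blinfun_apply (F x) = D x"
    "\<And>k. (\<And>b. b \<in> Basis \<Longrightarrow> k_times_differentiable_on k (\<lambda>x. D x b) S)
      \<Longrightarrow> k_times_differentiable_on k F S"
proof
  \<comment> \<open>\<open>T b w\<close> is the rank one map that sends h to (h \<bullet> b) w, so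
    \<open>F\<close> below is assembled from the columns \<open>D x b\<close>.\<close>
  define T where "T = (\<lambda>(b::'v) (w::'w). blinfun_scaleR_left w o\<^sub>L blinfun_inner_left b)"
  have T: "bounded_linear (T b)" for b
    unfolding T_def
    by (intro bounded_linear_compose[OF bounded_bilinear.bounded_linear_left[OF bounded_bilinear_blinfun_compose]]
        bounded_linear_blinfun_scaleR_left)
  define F where "F = (\<lambda>x. \<Sum>b\<in>Basis. T b (D x b))"
  show "blinfun_apply (F x) = D x" if "x \<in> S" for x
  proof
    fix h
    have "linear (D x)"
      using D that has_derivative_linear by blast
    then have "D x (\<Sum>b\<in>Basis. (h \<bullet> b) *\<^sub>R b) = (\<Sum>b\<in>Basis. (h \<bullet> b) *\<^sub>R D x b)"
      by (simp add: linear_sum linear_scale)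
    then show "F x h = D x h"
      by (simp add: euclidean_representation F_def T_def blinfun.sum_left)
  qed
  show "k_times_differentiable_on k F S"
    if "\<And>b. b \<in> Basis \<Longrightarrow> k_times_differentiable_on k (\<lambda>x. D x b) S" for k
    unfolding F_def
    by (intro k_times_differentiable_on_sum k_times_differentiable_on_linear_compose[OF _ T] assms(1) that)
qed

text \<open>The C^1 theorem gives the local inverse \<open>g\<close> with derivative the inverse of
  \<open>F (g y)\<close>. If \<open>g\<close> has order k, so do the composite of \<open>F\<close>
  with \<open>g\<close> and its inverse under composition; hence \<open>g\<close> has order k +
  1.\<close>

theorem smooth_inverse_function:
  fixes f :: "'v::euclidean_space \<Rightarrow> 'w::euclidean_space"
  assumes S: "open S" "x0 \<in> S" and f: "smooth_on f S"
    and D: "(f has_derivative D) (at x0)"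
    and L: "bounded_linear L" "\<And>v. L (D v) = v" "\<And>w. D (L w) = w"
  obtains U V g where "open U" "U \<subseteq> S" "x0 \<in> U" "open V" "homeomorphism U V f g" "smooth_on g V"
proof -
  \<comment> \<open>Composing with \<open>L\<close> gives a map of \<open>'v\<close> into itself, as
    the C^1 theorem requires, and makes its derivative at \<open>x0\<close> the identity. At the end
    \<open>L\<close> is moved over to the inverse.\<close>
  define f1 where "f1 = (\<lambda>x. L (f x))"
  have f1: "smooth_on f1 S"
    unfolding f1_def by (rule smooth_on_linear_compose[OF S(1) L(1) f])
  obtain D1 where D1: "\<And>x. x \<in> S \<Longrightarrow> (f1 has_derivative D1 x) (at x)"
    "\<And>v. smooth_on (\<lambda>x. D1 x v) S"
    using smooth_onE[OF S(1) f1] by blast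
  obtain F where F0: "\<And>x. x \<in> S \<Longrightarrow> blinfun_apply (F x) = D1 x"
    "\<And>k. (\<And>b. b \<in> Basis \<Longrightarrow> k_times_differentiable_on k (\<lambda>x. D1 x b) S)
      \<Longrightarrow> k_times_differentiable_on k F S"
    using blinfun_of_derivative[OF S(1) D1(1)] by blast
  have F: "\<And>x. x \<in> S \<Longrightarrow> (f1 has_derivative blinfun_apply (F x)) (at x)" "smooth_on F S"
    using F0 D1 by (auto simp: smooth_on_def)
  have "(f1 has_derivative (\<lambda>h. L (D h))) (at x0)"
    unfolding f1_def by (rule bounded_linear.has_derivative[OF L(1) D])
  from has_derivative_unique[OF F(1)[OF S(2)] this]
  have "blinfun_apply (F x0) = (\<lambda>h. h)" by (simp add: L(2))
  then have "id_blinfun o\<^sub>L F x0 = id_blinfun"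
    by (intro blinfun_eqI) simp
  from inverse_function_theorem[OF S(1) F(1) smooth_on_continuous_on[OF F(2)] S(2) this]
  obtain U V g g' where U: "open U" "U \<subseteq> S" "x0 \<in> U" and V: "open V" "f1 x0 \<in> V"
    and hom: "homeomorphism U V f1 g"
    and g: "\<And>y. y \<in> V \<Longrightarrow> (g has_derivative (g' y)) (at y)"
      "\<And>y. y \<in> V \<Longrightarrow> g' y = inv (blinfun_apply (F (g y)))"
      "\<And>y. y \<in> V \<Longrightarrow> bij (blinfun_apply (F (g y)))"
    by blast
  define B where "B = (\<lambda>y. Blinfun (g' y))"
  have B: "blinfun_apply (B y) = g' y" if "y \<in> V" for y
    unfolding B_def using g(1)[OF that] by (simp add: bounded_linear_Blinfun_apply has_derivative_bounded_linear)
  have inv: "F (g y) o\<^sub>L B y = id_blinfun" "B y o\<^sub>L F (g y) = id_blinfun" if "y \<in> V" for y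
    using g(3)[OF that] B[OF that] g(2)[OF that]
    by (auto intro!: blinfun_eqI simp: bij_is_surj surj_f_inv_f bij_is_inj)
  have gV: "g ` V \<subseteq> S"
    using hom U(2) by (auto simp: homeomorphism_def)
  have "k_times_differentiable_on k g V" for k
  proof (induction k)
    case 0
    show ?case using hom by (simp add: homeomorphism_def)
  next
    case (Suc k)
    have Fk: "k_times_differentiable_on k (\<lambda>y. F (g y)) V"
      using F(2) by (intro k_times_differentiable_on_compose[OF V(1) S(1) gV _ Suc]) (simp add: smooth_on_def)
    have Bk: "k_times_differentiable_on k B V"
      by (rule k_times_differentiable_on_bilinear_inverse
          [OF bounded_bilinear_blinfun_compose _ _ _ V(1) Fk inv]) (auto intro!: blinfun_eqI)
    show ?case
    proof (rule k_times_differentiable_on_SucI[OF V(1)])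
      show "(g has_derivative blinfun_apply (B y)) (at y)" if "y \<in> V" for y
        using g(1) B that by simp
      show "k_times_differentiable_on k (\<lambda>y. blinfun_apply (B y) b) V" for b
        by (rule k_times_differentiable_on_linear_compose[OF V(1) blinfun.bounded_linear_left Bk])
    qed
  qed
  then have g_smooth: "smooth_on g V" by (simp add: smooth_on_def)
  have oV: "open (L -` V)"
    using L(1) V(1) by (simp add: open_vimage linear_continuous_on)
  have ff: "f x = D (f1 x)" for x by (simp add: f1_def L)
  have h: "continuous_on V g" "f1 ` U = V" "g ` V = U"
    "\<And>x. x \<in> U \<Longrightarrow> g (f1 x) = x" "\<And>y. y \<in> V \<Longrightarrow> f1 (g y) = y"
    using hom by (simp_all add: homeomorphism_def)
  have "homeomorphism U (L -` V) f (\<lambda>y. g (L y))"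
  proof (rule homeomorphismI)
    show "continuous_on U f"
      using smooth_on_continuous_on[OF f] U(2) continuous_on_subset by blast
    show "continuous_on (L -` V) (\<lambda>y. g (L y))"
      by (rule continuous_on_compose2[OF h(1) linear_continuous_on[OF L(1)]]) auto
    show "f ` U \<subseteq> L -` V"
      using h(2) f1_def by blast
    show "(\<lambda>y. g (L y)) ` (L -` V) \<subseteq> U"
      using h(3) by blast
    show "g (L (f x)) = x" if "x \<in> U" for x
      using h(4)[OF that] unfolding f1_def .
    show "f (g (L y)) = y" if "y \<in> L -` V" for y
      using h(5)[of "L y"] that ff[of "g (L y)"] L(3) by simp
  qed
  moreover have "smooth_on (\<lambda>y. g (L y)) (L -` V)"
    by (rule smooth_on_compose[OF oV V(1) _ g_smooth smooth_on_linear[OF oV L(1)]]) auto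
  ultimately show ?thesis
    using that U oV by blast
qed

section \<open>Holomorphic functions of several variables are smooth\<close>

lemma norm_vector_smult: "norm (c *s v) = cmod c * norm (v :: complex^'n)"
  by (simp add: norm_vec_def norm_mult L2_set_right_distrib)

lemma bounded_linear_vector_smult_left: "bounded_linear (\<lambda>c::complex. c *s (v :: complex^'n::finite))"
  by (rule linear_conv_bounded_linear[THEN iffD1])
    (auto intro!: linearI simp: vec_eq_iff algebra_simps)

text \<open>Cauchy's formula for the first derivative of \<open>c \<mapsto> f (z + c *s v)\<close>
  at the centre of a disc; the velocity of the circle cancels one power in the denominator. The gain
  is that \<open>z\<close> enters the right side only inside the argument of \<open>f\<close>, with
  no derivative of \<open>f\<close> under the integral.\<close>

lemma complex_linear_derivative_circle_mean:
  fixes f :: "complex^'n::finite \<Rightarrow> complex"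
  assumes "open S" and D: "\<And>z. z \<in> S \<Longrightarrow> (f has_derivative D z) (at z)"
    and lin: "\<And>z c v. z \<in> S \<Longrightarrow> D z (c *s v) = c * D z v"
    and r: "r > 0" and S: "\<And>c. cmod c \<le> r \<Longrightarrow> z + c *s v \<in> S"
  shows "D z v = integral {0..1} (\<lambda>x. f (z + circlepath 0 r x *s v) / circlepath 0 r x)"
proof -
  define h where "h = (\<lambda>c. f (z + c *s v))"
  have line: "((\<lambda>c::complex. z + c *s v) has_derivative (\<lambda>d. d *s v)) (at c)" for c
    by (auto intro!: derivative_eq_intros bounded_linear_imp_has_derivative bounded_linear_vector_smult_left)
  have comm: "(\<lambda>d. d * a) = (*) a" for a :: complex
    by (simp add: fun_eq_iff mult.commute)
  have h: "(h has_field_derivative D (z + c *s v) v) (at c)" if "cmod c \<le> r" for c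
    using has_derivative_compose[OF line D[OF S[OF that]]] lin[OF S[OF that]]
    by (simp add: h_def has_field_derivative_def comm)
  have cont: "continuous_on (cball 0 r) h"
    by (rule DERIV_continuous_on) (use h has_field_derivative_at_within in fastforce)
  have hol: "h holomorphic_on ball 0 r"
    unfolding holomorphic_on_def field_differentiable_def
    using h has_field_derivative_at_within by (metis dist_0_norm less_imp_le mem_ball)
  have "D z v = deriv h 0"
    using DERIV_imp_deriv[OF h[of 0]] r by simp
  then have "2 * pi * \<i> * D z v = contour_integral (circlepath 0 r) (\<lambda>u. h u / (u - 0)^2)"
    using Cauchy_contour_integral_circlepath_2[OF cont hol, of 0] r by simp
  also have "\<dots> = integral {0..1} (\<lambda>x. h (circlepath 0 r x) / (circlepath 0 r x)^2
      * vector_derivative (circlepath 0 r) (at x))"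
    by (simp add: contour_integral_integral)
  also have "\<dots> = integral {0..1} (\<lambda>x. 2 * pi * \<i> * (h (circlepath 0 r x) / circlepath 0 r x))"
  proof (rule integral_cong)
    fix x :: real
    have "circlepath 0 r x \<noteq> 0" using r by (simp add: circlepath)
    moreover have "vector_derivative (circlepath 0 r) (at x) = 2 * pi * \<i> * circlepath 0 r x"
      unfolding vector_derivative_circlepath by (simp add: circlepath)
    ultimately show "h (circlepath 0 r x) / (circlepath 0 r x)^2 * vector_derivative (circlepath 0 r) (at x)
      = 2 * pi * \<i> * (h (circlepath 0 r x) / circlepath 0 r x)"
      by (simp add: power2_eq_square)
  qed
  also have "\<dots> = 2 * pi * \<i> * integral {0..1} (\<lambda>x. h (circlepath 0 r x) / circlepath 0 r x)"
    by (rule integral_mult_right)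
  finally show ?thesis by (simp add: h_def)
qed

lemma continuous_on_compose_circle:
  fixes h :: "complex^'n::finite \<Rightarrow> 'b::topological_space"
  assumes "continuous_on S h" and S: "\<And>y x. y \<in> A \<Longrightarrow> y + circlepath 0 r x *s v \<in> S"
  shows "continuous_on (A \<times> B) (\<lambda>(y, x). h (y + circlepath 0 r x *s v))"
proof -
  have "continuous_on (A \<times> B) (\<lambda>p. circlepath 0 r (snd p))"
    unfolding circlepath by (intro continuous_on_add continuous_on_mult continuous_on_exp
        continuous_on_of_real continuous_on_const continuous_on_snd[OF continuous_on_id])
  from continuous_on_add[OF continuous_on_fst[OF continuous_on_id]
      bounded_linear.continuous_on[OF bounded_linear_vector_smult_left this]]
  show ?thesis
    unfolding case_prod_unfold by (rule continuous_on_compose2[OF assms(1)]) (use S in auto)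
qed

text \<open>The circle formula is differentiated under the integral. The Leibniz rule asks for joint
  continuity of the differentiated integrand, which contains \<open>F\<close> along the circle, so
  \<open>D\<close> is first shown continuous, again by the circle formula. The new derivative is an
  integral of complex linear maps, hence complex linear.\<close>

lemma multi_holomorphic_derivative:
  fixes f :: "complex^'n::finite \<Rightarrow> complex"
  assumes "open S" and D: "\<And>z. z \<in> S \<Longrightarrow> (f has_derivative D z) (at z)"
    and lin: "\<And>z c v. z \<in> S \<Longrightarrow> D z (c *s v) = c * D z v"
    and v: "v \<in> Basis"
  shows "multi_holomorphic_on (\<lambda>z. D z v) S"
proof -
  have v1: "norm v = 1" if "v \<in> Basis" for v :: "complex^'n" using that by simp
  have cont_f: "continuous_on S f"
    using D by (auto intro!: continuous_at_imp_continuous_on intro: has_derivative_continuous)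
  \<comment> \<open>One radius must serve all centres y near z: half of \<open>e\<close> is spent on
    moving the centre and half on the circle around it, basis vectors having norm 1.\<close>
  have ball: "\<exists>r>0. \<forall>y\<in>ball z r. \<forall>c. \<forall>v\<in>Basis. cmod c \<le> r \<longrightarrow> y + c *s v \<in> S" if "z \<in> S" for z
  proof -
    obtain e where e: "e > 0" "ball z e \<subseteq> S"
      using openE[OF \<open>open S\<close> \<open>z \<in> S\<close>] by metis
    have "y + c *s v \<in> S" if "y \<in> ball z (e/2)" "v \<in> Basis" "cmod c \<le> e/2" for y c v
    proof -
      have "dist z (y + c *s v) \<le> dist z y + norm (c *s v)"
        using dist_triangle[of z "y + c *s v" y] by (simp add: dist_norm)
      then have "dist z (y + c *s v) < e"
        using that v1[OF that(2)] by (simp add: norm_vector_smult)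
      then show ?thesis
        using e(2) by auto
    qed
    then show ?thesis using e(1) by (intro exI[of _ "e/2"]) auto
  qed
  have "continuous_on S (\<lambda>z. D z b)" if b: "b \<in> Basis" for b
  proof (rule continuous_at_imp_continuous_on, rule ballI)
    fix z assume "z \<in> S"
    then obtain r where r: "r > 0" "\<And>y c v. y \<in> ball z r \<Longrightarrow> v \<in> Basis \<Longrightarrow> cmod c \<le> r \<Longrightarrow> y + c *s v \<in> S"
      using ball by blast
    have zb: "z \<in> ball z r" using r(1) by simp
    have in_S: "y + circlepath 0 r x *s b \<in> S" if "y \<in> ball z r" for y x
      using r that b by (simp add: circlepath norm_mult)
    have "continuous_on (ball z r) (\<lambda>y. integral (cbox 0 1) (\<lambda>x. f (y + circlepath 0 r x *s b) / circlepath 0 r x))"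
    proof (rule integral_continuous_on_param)
      have "continuous_on (ball z r \<times> cbox 0 1) (\<lambda>(y, x). f (y + circlepath 0 r x *s b))"
        by (rule continuous_on_compose_circle[OF cont_f in_S])
      then show "continuous_on (ball z r \<times> cbox 0 1) (\<lambda>(y, x). f (y + circlepath 0 r x *s b) / circlepath 0 r x)"
        using r(1) unfolding circlepath case_prod_unfold by (intro continuous_intros) auto
    qed
    then have "isCont (\<lambda>y. integral {0..1} (\<lambda>x. f (y + circlepath 0 r x *s b) / circlepath 0 r x)) z"
      using r(1) by (simp add: continuous_on_eq_continuous_at)
    moreover have "\<forall>\<^sub>F y in nhds z. integral {0..1} (\<lambda>x. f (y + circlepath 0 r x *s b) / circlepath 0 r x) = D y b"
      using eventually_nhds_in_open[OF open_ball zb]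
    proof eventually_elim
      case (elim y)
      show ?case
        by (rule complex_linear_derivative_circle_mean[OF \<open>open S\<close> D lin r(1), symmetric])
          (use r elim b in auto)
    qed
    ultimately show "isCont (\<lambda>z. D z b) z"
      using isCont_cong by fast
  qed
  moreover obtain F where F: "\<And>x. x \<in> S \<Longrightarrow> blinfun_apply (F x) = D x"
    "\<And>k. (\<And>b. b \<in> Basis \<Longrightarrow> k_times_differentiable_on k (\<lambda>x. D x b) S)
      \<Longrightarrow> k_times_differentiable_on k F S"
    using blinfun_of_derivative[OF \<open>open S\<close> D] by blast
  ultimately have cont_F: "continuous_on S F"
    using F(2)[of 0] by simp
  show ?thesis
    unfolding multi_holomorphic_on_def
  proof
    fix z assume "z \<in> S"
    then obtain r where r: "r > 0" "\<And>y c v. y \<in> ball z r \<Longrightarrow> v \<in> Basis \<Longrightarrow> cmod c \<le> r \<Longrightarrow> y + c *s v \<in> S"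
      using ball by blast
    have zb: "z \<in> ball z r" using r(1) by simp
    have in_S: "y + circlepath 0 r x *s v \<in> S" if "y \<in> ball z r" for y x
      using r that v by (simp add: circlepath norm_mult)
    \<comment> \<open>\<open>G y x\<close> is the derivative in y of the integrand at the circle
      parameter x, packaged as a bounded linear map.\<close>
    define G where "G = (\<lambda>y x. blinfun_mult_right (1 / circlepath 0 r x) o\<^sub>L F (y + circlepath 0 r x *s v))"
    have contG: "continuous_on (ball z r \<times> cbox 0 1) (\<lambda>(y, x). G y x)"
    proof -
      have 1: "continuous_on (ball z r \<times> cbox 0 1) (\<lambda>(y, x). F (y + circlepath 0 r x *s v))"
        by (rule continuous_on_compose_circle[OF cont_F in_S])
      have "continuous_on (ball z r \<times> cbox 0 1) (\<lambda>(y::complex^'n, x). 1 / circlepath 0 r x)"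
        using r(1) unfolding circlepath case_prod_unfold by (intro continuous_intros) auto
      then have "continuous_on (ball z r \<times> cbox 0 1) (\<lambda>(y::complex^'n, x). blinfun_mult_right (1 / circlepath 0 r x))"
        unfolding case_prod_unfold by (rule bounded_linear.continuous_on[OF bounded_linear_blinfun_mult_right])
      from bounded_bilinear.continuous_on[OF bounded_bilinear_blinfun_compose this 1]
      show ?thesis by (simp add: G_def case_prod_unfold)
    qed
    have "((\<lambda>y. integral (cbox 0 1) (\<lambda>x. f (y + circlepath 0 r x *s v) / circlepath 0 r x)) has_derivative
        integral (cbox 0 1) (G z)) (at z within ball z r)"
    proof (rule leibniz_rule[OF _ _ contG zb convex_ball])
      fix y and x :: real assume y: "y \<in> ball z r"
      have "((\<lambda>y. y + circlepath 0 r x *s v) has_derivative (\<lambda>h. h)) (at y)"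
        by (auto intro!: derivative_eq_intros)
      from has_derivative_compose[OF this D[OF in_S[OF y]]]
      have "((\<lambda>y. f (y + circlepath 0 r x *s v)) has_derivative D (y + circlepath 0 r x *s v)) (at y)"
        by simp
      from has_derivative_at_withinI[OF bounded_linear.has_derivative[OF
            bounded_linear_mult_right[of "1 / circlepath 0 r x"] this]]
      have "((\<lambda>y. f (y + circlepath 0 r x *s v) / circlepath 0 r x) has_derivative
          (\<lambda>h. 1 / circlepath 0 r x * D (y + circlepath 0 r x *s v) h)) (at y within ball z r)"
        by simp
      moreover have "blinfun_apply (G y x) = (\<lambda>h. 1 / circlepath 0 r x * D (y + circlepath 0 r x *s v) h)"
        by (simp add: fun_eq_iff G_def F(1)[OF in_S[OF y]] blinfun_mult_right.rep_eq)
      ultimately show "((\<lambda>y. f (y + circlepath 0 r x *s v) / circlepath 0 r x) has_derivative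
          blinfun_apply (G y x)) (at y within ball z r)"
        by simp
    next
      fix y assume y: "y \<in> ball z r"
      show "(\<lambda>x. f (y + circlepath 0 r x *s v) / circlepath 0 r x) integrable_on cbox 0 1"
      proof (rule integrable_continuous)
        have "continuous_on ({y} \<times> cbox 0 1) (\<lambda>(y, x). f (y + circlepath 0 r x *s v))"
          by (rule continuous_on_compose_circle[OF cont_f]) (use in_S[OF y] in auto)
        from continuous_on_compose2[OF this, of "cbox 0 1" "\<lambda>x. (y, x)"]
        have "continuous_on (cbox 0 1) (\<lambda>x. f (y + circlepath 0 r x *s v))"
          by (simp add: continuous_on_Pair image_subset_iff)
        then show "continuous_on (cbox 0 1) (\<lambda>x. f (y + circlepath 0 r x *s v) / circlepath 0 r x)"
          using r(1) unfolding circlepath by (intro continuous_intros) auto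
      qed
    qed
    then have "((\<lambda>y. integral {0..1} (\<lambda>x. f (y + circlepath 0 r x *s v) / circlepath 0 r x)) has_derivative
        integral (cbox 0 1) (G z)) (at z)"
      using at_within_open[OF zb] by simp
    then have deriv: "((\<lambda>y. D y v) has_derivative integral (cbox 0 1) (G z)) (at z)"
    proof (rule has_derivative_transform_within_open[OF _ open_ball zb])
      fix y assume "y \<in> ball z r"
      then show "integral {0..1} (\<lambda>x. f (y + circlepath 0 r x *s v) / circlepath 0 r x) = D y v"
        by (intro complex_linear_derivative_circle_mean[OF \<open>open S\<close> D lin r(1), symmetric]) (use r v in auto)
    qed
    have "continuous_on (cbox 0 1) (G z)"
      using continuous_on_compose2[OF contG, of "cbox 0 1" "\<lambda>x. (z, x)"] zb
      by (simp add: continuous_on_Pair continuous_on_const image_subset_iff)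
    then have int: "G z integrable_on cbox 0 1"
      by (rule integrable_continuous)
    have "integral (cbox 0 1) (G z) (c *s h) = c * integral (cbox 0 1) (G z) h" for c h
    proof -
      have "G z x (c *s h) = c * G z x h" for x
        by (simp add: G_def F(1)[OF in_S[OF zb]] lin[OF in_S[OF zb]] blinfun_mult_right.rep_eq)
      then show ?thesis
        using blinfun_apply_integral[OF int] by simp
    qed
    with deriv show "\<exists>f'. ((\<lambda>z. D z v) has_derivative f') (at z) \<and> (\<forall>c v. f' (c *s v) = c * f' v)"
      by blast
  qed
qed

text \<open>The induction runs over all holomorphic functions at once, because each basis component
  of the derivative is holomorphic again.\<close>

theorem multi_holomorphic_smooth_on:
  assumes "open S" "multi_holomorphic_on f S"
  shows "smooth_on f S"
proof -
  have "k_times_differentiable_on k f S" for k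
    using assms(2)
  proof (induction k arbitrary: f)
    case 0
    then show ?case
      unfolding multi_holomorphic_on_def
      by (auto intro!: continuous_at_imp_continuous_on) (meson has_derivative_continuous)
  next
    case (Suc k)
    from Suc.prems obtain D where D: "\<And>z. z \<in> S \<Longrightarrow> (f has_derivative D z) (at z)"
      "\<And>z c v. z \<in> S \<Longrightarrow> D z (c *s v) = c * D z v"
      unfolding multi_holomorphic_on_def by metis
    show ?case
      by (rule k_times_differentiable_on_SucI[OF assms(1) D(1)])
        (auto intro!: Suc.IH multi_holomorphic_derivative[OF assms(1) D])
  qed
  then show ?thesis by (simp add: smooth_on_def)
qed

section \<open>Diagonalisation of symmetric matrices\<close>

text \<open>An extremal argument: by compactness some unit vector \<open>v\<close> of
  \<open>S\<close> maximises x \<bullet> f x, and the vanishing first variation makes m v - f v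
  orthogonal to \<open>S\<close>. Invariance of \<open>S\<close> puts this vector in
  \<open>S\<close>, so it is zero.\<close>

lemma self_adjoint_eigenvector:
  fixes f :: "'a::euclidean_space \<Rightarrow> 'a"
  assumes lin: "linear f" and sym: "\<And>x y. f x \<bullet> y = x \<bullet> f y"
    and S: "subspace S" "f ` S \<subseteq> S" "S \<noteq> {0}"
  obtains v c where "v \<in> S" "norm v = 1" "f v = c *\<^sub>R v"
proof -
  let ?K = "S \<inter> sphere 0 1"
  have "compact ?K"
    by (simp add: closed_Int_compact closed_subspace S(1))
  moreover have "?K \<noteq> {}"
  proof -
    obtain x where "x \<in> S" "x \<noteq> 0"
      using S(1,3) subspace_0 by blast
    then have "x /\<^sub>R norm x \<in> ?K"
      using S(1) by (simp add: subspace_scale)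
    then show ?thesis by blast
  qed
  moreover have "continuous_on ?K (\<lambda>x. x \<bullet> f x)"
    by (intro continuous_intros linear_continuous_on) (simp add: lin linear_conv_bounded_linear[symmetric])
  ultimately obtain v where v: "v \<in> ?K" "\<And>y. y \<in> ?K \<Longrightarrow> y \<bullet> f y \<le> v \<bullet> f v"
    using continuous_attains_sup by metis
  define m where "m = v \<bullet> f v"
  have vS: "v \<in> S" "norm v = 1" using v(1) by auto
  have bound: "y \<bullet> f y \<le> m * (y \<bullet> y)" if "y \<in> S" for y
  proof (cases "y = 0")
    case True
    then show ?thesis by simp
  next
    case False
    have "y /\<^sub>R norm y \<in> ?K"
      using S(1) that False by (simp add: subspace_scale)
    from v(2)[OF this] have "(y \<bullet> f y) / (norm y)\<^sup>2 \<le> m"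
      by (simp add: m_def linear_scale[OF lin] power2_eq_square divide_inverse mult_ac)
    then show ?thesis
      using False by (simp add: divide_le_eq power2_norm_eq_inner)
  qed
  have orth: "(m *\<^sub>R v - f v) \<bullet> y = 0" if y: "y \<in> S" for y
  proof (rule ccontr)
    define a b where "a = (m *\<^sub>R v - f v) \<bullet> y" and "b = m * (y \<bullet> y) - y \<bullet> f y"
    assume "(m *\<^sub>R v - f v) \<bullet> y \<noteq> 0"
    then have a: "a \<noteq> 0" by (simp add: a_def)
    have b: "b \<ge> 0" using bound[OF y] by (simp add: b_def)
    \<comment> \<open>The right side is the gap in \<open>bound\<close> at the vector v + t y. It
      vanishes at t = 0, where its slope is 2 a, so a nonzero \<open>a\<close> would make it
      negative for some t.\<close>
    have q: "0 \<le> 2 * t * a + t\<^sup>2 * b" for t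
    proof -
      have "v \<bullet> v = 1" using vS(2) by (simp add: norm_eq_sqrt_inner)
      then have "m * ((v + t *\<^sub>R y) \<bullet> (v + t *\<^sub>R y)) - (v + t *\<^sub>R y) \<bullet> f (v + t *\<^sub>R y) = 2 * t * a + t\<^sup>2 * b"
        using sym[of v y]
        by (simp add: a_def b_def m_def linear_add[OF lin] linear_scale[OF lin] inner_simps
            inner_commute power2_eq_square algebra_simps)
      moreover have "v + t *\<^sub>R y \<in> S"
        using S(1) vS(1) y by (simp add: subspace_add subspace_scale)
      ultimately show ?thesis using bound[of "v + t *\<^sub>R y"] by simp
    qed
    \<comment> \<open>The parabola is lowest at t = - a / b; taking b + 1 for b keeps the
      denominator positive when b = 0 and still gives a negative value.\<close>
    have "2 * (- a / (b + 1)) * a + (- a / (b + 1))\<^sup>2 * b = - (a\<^sup>2 * (b + 2)) / (b + 1)\<^sup>2"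
      using b by (simp add: power2_eq_square field_simps add_nonneg_eq_0_iff)
    also have "\<dots> < 0"
      using a b by (simp add: divide_neg_pos)
    finally show False using q[of "- a / (b + 1)"] by simp
  qed
  have "m *\<^sub>R v - f v \<in> S"
    using S vS(1) by (auto intro!: subspace_diff subspace_scale)
  then have "f v = m *\<^sub>R v"
    using orth[of "m *\<^sub>R v - f v"] by simp
  with vS that show ?thesis by blast
qed

text \<open>Split off one unit eigenvector and recurse on its orthogonal complement in
  \<open>S\<close>, which is invariant by self-adjointness and of smaller dimension.\<close>

lemma self_adjoint_orthonormal_eigenbasis:
  fixes f :: "'a::euclidean_space \<Rightarrow> 'a"
  assumes lin: "linear f" and sym: "\<And>x y. f x \<bullet> y = x \<bullet> f y"
    and S: "subspace S" "f ` S \<subseteq> S"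
  shows "\<exists>B. B \<subseteq> S \<and> pairwise orthogonal B \<and> (\<forall>b\<in>B. norm b = 1 \<and> (\<exists>c. f b = c *\<^sub>R b)) \<and> span B = S"
  using S
proof (induction "dim S" arbitrary: S rule: less_induct)
  case less
  show ?case
  proof (cases "S = {0}")
    case True
    then show ?thesis by (intro exI[of _ "{}"]) auto
  next
    case False
    obtain v c where v: "v \<in> S" "norm v = 1" "f v = c *\<^sub>R v"
      using self_adjoint_eigenvector[OF lin sym less.prems False] by blast
    have vv: "v \<bullet> v = 1" using v(2) by (simp add: norm_eq_sqrt_inner)
    define T where "T = S \<inter> {x. v \<bullet> x = 0}"
    have T: "subspace T"
      unfolding T_def by (intro subspace_inter subspace_hyperplane less.prems)
    have "f x \<in> T" if "x \<in> T" for x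
      using less.prems(2) sym[of v x] v(3) that by (auto simp: T_def)
    then have "f ` T \<subseteq> T" by blast
    moreover have "dim T < dim S"
    proof (rule dim_psubset)
      have "v \<notin> T" by (simp add: T_def vv)
      moreover have "span T = T" "span S = S"
        using T less.prems(1) by (simp_all add: span_eq_iff)
      ultimately show "span T \<subset> span S"
        using v(1) T_def by blast
    qed
    ultimately obtain B where B: "B \<subseteq> T" "pairwise orthogonal B"
      "\<forall>b\<in>B. norm b = 1 \<and> (\<exists>c. f b = c *\<^sub>R b)" "span B = T"
      using less.hyps T by metis
    have "span (insert v B) = S"
    proof
      show "span (insert v B) \<subseteq> S"
        using v B(1) less.prems(1) by (intro span_minimal) (auto simp: T_def)
      show "S \<subseteq> span (insert v B)"
      proof
        fix x assume "x \<in> S"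
        then have "x - (v \<bullet> x) *\<^sub>R v \<in> T"
          using less.prems(1) v(1) vv
          by (auto simp: T_def inner_simps intro!: subspace_diff subspace_scale)
        then show "x \<in> span (insert v B)"
          using B(4) span_breakdown_eq by blast
      qed
    qed
    moreover have "pairwise orthogonal (insert v B)"
      using B(1,2) by (auto simp: pairwise_insert T_def orthogonal_def inner_commute)
    ultimately show ?thesis
      using B v by (intro exI[of _ "insert v B"]) (auto simp: T_def)
  qed
qed

section \<open>Eigenbases, negative eigenvalues and the sign normal form of symmetric
  matrices\<close>

definition diag :: "('k::finite \<Rightarrow> real) \<Rightarrow> real^'k^'k" where
  "diag s = (\<chi> i j. if i = j then s i else 0)"

lemma diag_mult_vec: "diag s *v x = (\<chi> i. s i * x $ i)"
  by (simp add: diag_def matrix_vector_mult_def vec_eq_iff if_distrib[of "\<lambda>c. c * _"] cong: if_cong)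

lemma transpose_diag: "transpose (diag s) = diag s"
  by (simp add: diag_def transpose_def vec_eq_iff)

lemma diag_mult_diag: "diag s ** diag t = diag (\<lambda>i. s i * t i)"
  by (simp add: diag_def matrix_matrix_mult_def vec_eq_iff if_distrib[of "\<lambda>c. c * _"] cong: if_cong)

lemma symmetric_eigenbasis:
  fixes H :: "real^'k^'k::finite"
  assumes "transpose H = H"
  obtains b :: "'k \<Rightarrow> real^'k" and d where "\<And>i j. b i \<bullet> b j = (if i = j then 1 else 0)" "\<And>i. H *v b i = d i *\<^sub>R b i"
proof -
  have "(H *v x) \<bullet> y = x \<bullet> (H *v y)" for x y
    using dot_lmul_matrix[of x H y] assms by (metis transpose_matrix_vector)
  from self_adjoint_orthonormal_eigenbasis[OF matrix_vector_mul_linear this, of UNIV]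
  obtain B where B: "pairwise orthogonal B"
    "\<forall>b\<in>B. norm b = 1 \<and> (\<exists>c. H *v b = c *\<^sub>R b)" "span B = UNIV" by auto
  have "0 \<notin> B" using B(2) by force
  then have ind: "independent B"
    using B(1) pairwise_orthogonal_independent by blast
  then have "card B = CARD('k)"
    using B(3) dim_eq_card_independent[OF ind] by (metis dim_span dim_UNIV DIM_cart DIM_real mult.right_neutral)
  moreover have "finite B" using ind by (rule independent_imp_finite)
  ultimately obtain b where b: "bij_betw b (UNIV :: 'k set) B"
    by (metis finite_same_card_bij finite_class.finite_UNIV)
  then have bB: "b i \<in> B" for i by (auto simp: bij_betw_def)
  have "\<forall>i. \<exists>c. H *v b i = c *\<^sub>R b i"
    using B(2) bB by blast
  then obtain d where "\<forall>i. H *v b i = d i *\<^sub>R b i"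
    using choice[of "\<lambda>i c. H *v b i = c *\<^sub>R b i"] by blast
  moreover have "b i \<bullet> b j = (if i = j then 1 else 0)" for i j
  proof (cases "i = j")
    case True
    have "norm (b j) = 1" using B(2) bB by blast
    with True show ?thesis by (simp add: norm_eq_1)
  next
    case False
    then have "b i \<noteq> b j" using b by (auto simp: bij_betw_def dest: injD)
    then have "orthogonal (b i) (b j)" using B(1) bB by (simp add: pairwise_def)
    then show ?thesis using False by (simp add: orthogonal_def)
  qed
  ultimately show ?thesis by (intro that[of b d]) auto
qed

text \<open>The square matrix with rows \<open>b i\<close> has its transpose as a right inverse,
  hence also as a left inverse; the latter identity applied to \<open>v\<close> is the
  expansion.\<close>

lemma orthonormal_family_expansion:
  fixes b :: "'k::finite \<Rightarrow> real^'k"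
  assumes "\<And>i j. b i \<bullet> b j = (if i = j then 1 else 0)"
  shows "v = (\<Sum>i\<in>UNIV. (b i \<bullet> v) *\<^sub>R b i)"
proof -
  define P :: "real^'k^'k" where "P = (\<chi> i. b i)"
  have "P ** transpose P = mat 1"
    using assms by (simp add: P_def matrix_matrix_mult_def transpose_def mat_def vec_eq_iff inner_vec_def)
  then have "transpose P ** P = mat 1"
    using matrix_left_right_inverse by blast
  then have "v = transpose P *v (P *v v)"
    by (metis matrix_vector_mul_assoc matrix_vector_mul_lid)
  also have "\<dots> = (\<Sum>i\<in>UNIV. (b i \<bullet> v) *\<^sub>R b i)"
    by (simp add: P_def matrix_vector_mult_def transpose_def vec_eq_iff inner_vec_def mult_ac)
  finally show ?thesis .
qed

text \<open>The eigenspace for e is spanned by the \<open>b i\<close> with \<open>d i = e\<close>,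
  so its dimension counts these indices. Summing over the distinct negative e meets each index with
  \<open>d i < 0\<close> exactly once.\<close>

lemma negative_eigenvalue_count_eigenbasis:
  fixes H :: "real^'k^'k::finite" and b :: "'k \<Rightarrow> real^'k"
  assumes b: "\<And>i j. b i \<bullet> b j = (if i = j then 1 else 0)" and H: "\<And>i. H *v b i = d i *\<^sub>R b i"
  shows "negative_eigenvalue_count H = card {i. d i < 0}"
proof -
  have b1: "b i \<bullet> b i = 1" for i using b by simp
  have inj: "inj b"
    by (rule injI) (metis b zero_neq_one)
  have dot: "b i \<bullet> (H *v v) = d i * (b i \<bullet> v)" for i v
  proof -
    have "H *v v = (\<Sum>j\<in>UNIV. (b j \<bullet> v) *\<^sub>R (d j *\<^sub>R b j))"
      by (subst orthonormal_family_expansion[OF b, of v])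
        (simp add: linear_sum[OF matrix_vector_mul_linear] linear_scale[OF matrix_vector_mul_linear] H)
    then show ?thesis
      by (simp add: inner_sum_right b if_distrib[of "\<lambda>c. _ * c"] mult_ac cong: if_cong)
  qed
  have es: "eigenspace H e = span (b ` {i. d i = e})" for e
  proof
    show "span (b ` {i. d i = e}) \<subseteq> eigenspace H e"
    proof (rule span_minimal)
      show "subspace (eigenspace H e)"
        by (auto simp: eigenspace_def subspace_def matrix_vector_right_distrib scaleR_right_distrib
            linear_scale[OF matrix_vector_mul_linear])
    qed (auto simp: eigenspace_def H)
    show "eigenspace H e \<subseteq> span (b ` {i. d i = e})"
    proof
      fix v assume "v \<in> eigenspace H e"
      then have "d i * (b i \<bullet> v) = e * (b i \<bullet> v)" for i
        using dot[of i v] by (auto simp: eigenspace_def)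
      then have "b i \<bullet> v = 0 \<or> d i = e" for i
        by simp
      then have "(b i \<bullet> v) *\<^sub>R b i \<in> span (b ` {i. d i = e})" for i
        by (metis (mono_tags) imageI mem_Collect_eq scaleR_zero_left span_base span_scale span_zero)
      then have "(\<Sum>i\<in>UNIV. (b i \<bullet> v) *\<^sub>R b i) \<in> span (b ` {i. d i = e})"
        by (intro span_sum)
      then show "v \<in> span (b ` {i. d i = e})"
        using orthonormal_family_expansion[OF b, of v] by simp
    qed
  qed
  have ind: "independent (b ` A)" for A
  proof (rule pairwise_orthogonal_independent)
    show "pairwise orthogonal (b ` A)"
      by (auto simp: pairwise_def orthogonal_def b)
    show "0 \<notin> b ` A" using b1 by (metis imageE inner_zero_left zero_neq_one)
  qed
  have dim: "dim (eigenspace H e) = card {i. d i = e}" for e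
    unfolding es dim_span dim_eq_card_independent[OF ind]
    by (rule card_image) (use inj inj_on_subset in blast)
  \<comment> \<open>The definition sums over a set of reals; as an image of indices it is finite,
    and the summands become sizes of fibres of \<open>d\<close>.\<close>
  have "{e. e < 0 \<and> eigenspace H e \<noteq> {0}} = d ` {i. d i < 0}"
  proof -
    have "eigenspace H e \<noteq> {0} \<longleftrightarrow> {i. d i = e} \<noteq> {}" for e
    proof -
      have "0 \<in> eigenspace H e" by (simp add: eigenspace_def)
      then have "eigenspace H e = {0} \<longleftrightarrow> dim (eigenspace H e) = 0"
        using dim_eq_0[of "eigenspace H e"] by blast
      then show ?thesis unfolding dim by simp
    qed
    then show ?thesis by auto
  qed
  then have "negative_eigenvalue_count H = (\<Sum>e\<in>d ` {i. d i < 0}. card {i. d i = e})"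
    unfolding negative_eigenvalue_count_def dim by simp
  also have "\<dots> = (\<Sum>e\<in>d ` {i. d i < 0}. card {i \<in> {i. d i < 0}. d i = e})"
    by (rule sum.cong) (auto intro!: arg_cong[where f = card])
  also have "\<dots> = card {i. d i < 0}"
    using sum.image_gen[of "{i. d i < 0}" "\<lambda>_. 1::nat" d] by (simp only: card_eq_sum finite)
  finally show ?thesis .
qed

text \<open>Take the signs of the eigenvalues, all nonzero by invertibility, and scale the rows of
  an orthonormal eigenbasis by sqrt |d i|. The counts cover every multiple c H because the Hessian
  at each time is one; for c < 0 the negative eigenvalues come from the indices with d i > 0, the
  complement of those before.\<close>

theorem nondegenerate_symmetric_matrix_normal_form:
  fixes H :: "real^'k^'k::finite"
  assumes sym: "transpose H = H" and inv: "invertible H"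
  obtains P :: "real^'k^'k" and s where "invertible P" "\<And>i. s i = 1 \<or> s i = - 1" "H = transpose P ** diag s ** P"
    "\<And>c. c > 0 \<Longrightarrow> negative_eigenvalue_count (c *\<^sub>R H) = card {i. s i = - 1}"
    "\<And>c. c < 0 \<Longrightarrow> negative_eigenvalue_count (c *\<^sub>R H) = CARD('k) - card {i. s i = - 1}"
proof -
  obtain b :: "'k \<Rightarrow> real^'k" and d where b: "\<And>i j. b i \<bullet> b j = (if i = j then 1 else 0)" and Hb: "\<And>i. H *v b i = d i *\<^sub>R b i"
    using symmetric_eigenbasis[OF sym] by blast
  have d: "d i \<noteq> 0" for i
  proof
    assume "d i = 0"
    then have "H *v b i = H *v 0" using Hb by simp
    then have "b i = 0"
      using inv by (metis inj_matrix_vector_mult injD)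
    then show False using b[of i i] by simp
  qed
  define s where "s = (\<lambda>i. sgn (d i))"
  define P where "P = (\<chi> i. sqrt \<bar>d i\<bar> *\<^sub>R b i)"
  have P: "P *v v = (\<chi> i. sqrt \<bar>d i\<bar> * (b i \<bullet> v))" for v
    by (simp add: P_def matrix_vector_mult_def inner_vec_def vec_eq_iff sum_distrib_left mult_ac)
  have PT: "transpose P *v w = (\<Sum>i\<in>UNIV. (sqrt \<bar>d i\<bar> * w $ i) *\<^sub>R b i)" for w
    by (simp add: P_def matrix_vector_mult_def transpose_def vec_eq_iff mult_ac)
  have "H = transpose P ** diag s ** P"
  proof (rule matrix_eq[THEN iffD2], rule allI)
    fix v
    have "(transpose P ** diag s ** P) *v v = transpose P *v (diag s *v (P *v v))"
      by (simp add: matrix_vector_mul_assoc matrix_mul_assoc)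
    also have "\<dots> = (\<Sum>i\<in>UNIV. (d i * (b i \<bullet> v)) *\<^sub>R b i)"
    proof -
      have "sqrt \<bar>d i\<bar> * (s i * (sqrt \<bar>d i\<bar> * c)) = d i * c" for i c
      proof -
        have "sqrt \<bar>d i\<bar> * sqrt \<bar>d i\<bar> * s i = d i"
          by (simp add: s_def abs_mult_sgn)
        then show ?thesis by (metis mult.assoc mult.commute)
      qed
      then show ?thesis
        unfolding P PT diag_mult_vec by (simp only: vec_lambda_beta)
    qed
    also have "\<dots> = H *v (\<Sum>i\<in>UNIV. (b i \<bullet> v) *\<^sub>R b i)"
      by (simp add: linear_sum[OF matrix_vector_mul_linear] linear_scale[OF matrix_vector_mul_linear] Hb mult_ac)
    finally show "H *v v = (transpose P ** diag s ** P) *v v"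
      using orthonormal_family_expansion[OF b, of v] by simp
  qed
  moreover have "invertible P"
    unfolding invertible_left_inverse matrix_left_invertible_injective
  proof (rule injI)
    fix x y assume "P *v x = P *v y"
    then have "b i \<bullet> x = b i \<bullet> y" for i
      using d by (simp add: P vec_eq_iff)
    then show "x = y"
      using orthonormal_family_expansion[OF b, of x] orthonormal_family_expansion[OF b, of y] by simp
  qed
  moreover have "s i = 1 \<or> s i = - 1" for i
    using d[of i] by (simp add: s_def sgn_if)
  moreover have cnt: "negative_eigenvalue_count (c *\<^sub>R H) = card {i. c * d i < 0}" for c
  proof (rule negative_eigenvalue_count_eigenbasis[OF b])
    show "(c *\<^sub>R H) *v b i = (c * d i) *\<^sub>R b i" for i
      by (simp add: scaleR_matrix_vector_assoc[symmetric] Hb)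
  qed
  moreover have s_neg: "s i = - 1 \<longleftrightarrow> d i < 0" for i
    using d[of i] by (simp add: s_def sgn_if)
  then have "{i. c * d i < 0} = {i. s i = - 1}" if "c > 0" for c
    using that by (auto simp: mult_less_0_iff)
  moreover have "card {i. c * d i < 0} = CARD('k) - card {i. s i = - 1}" if "c < 0" for c
  proof -
    have "{i. c * d i < 0} = UNIV - {i. s i = - 1}"
      using that d by (auto simp: s_neg mult_less_0_iff not_less le_less)
    then show ?thesis by (simp add: card_Diff_subset)
  qed
  ultimately show ?thesis using that[of P s] by simp
qed

section \<open>Quadratic forms with smooth coefficients\<close>

lemma matrix_inv_right: "invertible A \<Longrightarrow> A ** matrix_inv A = mat 1"
  and matrix_inv_left: "invertible A \<Longrightarrow> matrix_inv A ** A = mat 1"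
  unfolding invertible_def matrix_inv_def
  using someI_ex[of "\<lambda>A'. A ** A' = mat 1 \<and> A' ** A = mat 1"] by auto

lemma bounded_bilinear_matrix_mult:
  "bounded_bilinear ((**) :: 'a::{euclidean_space,real_normed_field}^'n::finite^'m::finite \<Rightarrow> 'a^'k::finite^'n \<Rightarrow> 'a^'k^'m)"
  unfolding bilinear_conv_bounded_bilinear[symmetric] bilinear_def
  by (auto intro!: linearI simp: matrix_matrix_mult_def vec_eq_iff sum.distrib algebra_simps scaleR_sum_right)

lemma bounded_bilinear_matrix_vector_mult:
  "bounded_bilinear ((*v) :: real^'n::finite^'m::finite \<Rightarrow> real^'n \<Rightarrow> real^'m)"
  unfolding bilinear_conv_bounded_bilinear[symmetric] bilinear_def
  by (auto intro!: linearI simp: matrix_vector_mult_def vec_eq_iff sum.distrib algebra_simps sum_distrib_left)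

lemma bounded_linear_transpose: "bounded_linear (transpose :: 'a::euclidean_space^'n::finite^'m::finite \<Rightarrow> 'a^'m^'n)"
  unfolding linear_conv_bounded_linear[symmetric]
  by (auto intro!: linearI simp: transpose_def vec_eq_iff)

text \<open>Squaring has derivative h + h at the identity, which halving inverts. The homeomorphism
  is kept in the conclusion because injectivity of squaring on \<open>U\<close> gives uniqueness of
  the root there.\<close>

lemma smooth_matrix_sqrt:
  obtains U V :: "(real^'k^'k::finite) set" and R where "open U" "mat 1 \<in> U" "open V" "mat 1 \<in> V"
    "homeomorphism U V (\<lambda>S. S ** S) R" "smooth_on R V"
proof -
  have smooth: "smooth_on (\<lambda>S :: real^'k^'k. S ** S) UNIV"
    by (rule smooth_on_bilinear[OF open_UNIV bounded_bilinear_matrix_mult])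
      (rule smooth_on_linear[OF open_UNIV bounded_linear_ident])+
  have D: "((\<lambda>S :: real^'k^'k. S ** S) has_derivative (\<lambda>h. h + h)) (at (mat 1))"
    using bounded_bilinear.FDERIV[OF bounded_bilinear_matrix_mult has_derivative_ident has_derivative_ident, of "mat 1 :: real^'k^'k" UNIV]
    by simp
  obtain U V R where "open U" "mat 1 \<in> U" "open V" "homeomorphism U V (\<lambda>S :: real^'k^'k. S ** S) R" "smooth_on R V"
    by (rule smooth_inverse_function[OF open_UNIV UNIV_I smooth D bounded_linear_scaleR_right[of "1/2"]])
      (auto simp: scaleR_2[symmetric] scaleR_half_double)
  note UV = this
  have "(mat 1 :: real^'k^'k) ** mat 1 \<in> V"
    using UV(2) homeomorphism_image1[OF UV(4)] by blast
  then show ?thesis using that[OF UV(1,2,3) _ UV(4,5)] by simp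
qed

text \<open>For \<open>E = diag s\<close> with \<open>s = \<plusminus>1\<close>, both \<open>R\<close> and \<open>E R\<^sup>T E\<close> are square roots of \<open>E Q\<close> near the
  identity, hence equal; this gives \<open>R\<^sup>T E R = E R R = Q\<close>.\<close>

lemma smooth_symmetric_congruence:
  fixes Q :: "'v::euclidean_space \<Rightarrow> real^'k^'k::finite"
  assumes S: "open S" "z0 \<in> S" and Q: "smooth_on Q S" "\<And>z. z \<in> S \<Longrightarrow> transpose (Q z) = Q z"
    and s: "\<And>i. s i = 1 \<or> s i = - 1"
    and C: "invertible C" "Q z0 = transpose C ** diag s ** C"
  obtains S' and P :: "'v \<Rightarrow> real^'k^'k" where "open S'" "S' \<subseteq> S" "z0 \<in> S'" "smooth_on P S'" "P z0 = C"
    "\<And>z. z \<in> S' \<Longrightarrow> Q z = transpose (P z) ** diag s ** P z"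
proof -
  let ?E = "diag s"
  define Ci where "Ci = matrix_inv C"
  have Ci: "C ** Ci = mat 1" "Ci ** C = mat 1"
    using C(1) unfolding Ci_def by (simp_all add: matrix_inv_right matrix_inv_left)
  then have CiT: "transpose Ci ** transpose C = mat 1" "transpose C ** transpose Ci = mat 1"
    by (metis matrix_transpose_mul transpose_mat)+
  have EE: "?E ** ?E = mat 1"
  proof -
    have "(\<lambda>i. s i * s i) = (\<lambda>i. 1)"
      using s by (auto simp: fun_eq_iff) (metis mult_1 mult_minus1 minus_minus)
    then show ?thesis
      by (simp add: diag_mult_diag) (simp add: diag_def mat_def)
  qed
  obtain U V :: "(real^'k^'k) set" and R where UV: "open U" "mat 1 \<in> U" "open V" "mat 1 \<in> V"
    "homeomorphism U V (\<lambda>S. S ** S) R" "smooth_on R V"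
    using smooth_matrix_sqrt by blast
  have R: "R (X ** X) = X" if "X \<in> U" for X
    using UV(5) that by (simp add: homeomorphism_def)
  have R2: "R Y ** R Y = Y" if "Y \<in> V" for Y
    using UV(5) that by (simp add: homeomorphism_def)
  \<comment> \<open>Changing basis by the inverse of \<open>C\<close> turns \<open>Q z0\<close> into
    \<open>diag s\<close>, so \<open>T z0 = mat 1\<close> and the root \<open>R\<close> applies to
    \<open>T z\<close> for z near z0.\<close>
  define Q' where "Q' = (\<lambda>z. transpose Ci ** Q z ** Ci)"
  define T where "T = (\<lambda>z. ?E ** Q' z)"
  have Q': "smooth_on Q' S"
    unfolding Q'_def by (intro smooth_on_bilinear[OF S(1) bounded_bilinear_matrix_mult] smooth_on_const S(1) Q(1))
  have T: "smooth_on T S"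
    unfolding T_def by (intro smooth_on_bilinear[OF S(1) bounded_bilinear_matrix_mult] smooth_on_const S(1) Q')
  have Q'_sym: "transpose (Q' z) = Q' z" if "z \<in> S" for z
    by (simp add: Q'_def matrix_transpose_mul Q(2)[OF that] matrix_mul_assoc)
  have "Q' z0 = (transpose Ci ** transpose C) ** ?E ** (C ** Ci)"
    unfolding Q'_def C(2) by (simp only: matrix_mul_assoc)
  then have T0: "T z0 = mat 1"
    by (simp add: T_def Ci CiT EE)
  define S1 where "S1 = S \<inter> T -` V"
  have S1: "open S1" "S1 \<subseteq> S" "z0 \<in> S1"
    using continuous_open_preimage[OF smooth_on_continuous_on[OF T] S(1) UV(3)] S(2) UV(4) T0
    by (auto simp: S1_def)
  define M where "M = (\<lambda>z. R (T z))"
  have M: "smooth_on M S1"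
    unfolding M_def by (rule smooth_on_compose[OF S1(1) UV(3) _ UV(6) smooth_on_subset[OF T S1(2)]]) (auto simp: S1_def)
  have M0: "M z0 = mat 1"
    using R[OF UV(2)] by (simp add: M_def T0)
  define N where "N = (\<lambda>z. ?E ** transpose (M z) ** ?E)"
  have N: "smooth_on N S1"
    unfolding N_def
    by (intro smooth_on_bilinear[OF S1(1) bounded_bilinear_matrix_mult] smooth_on_const S1(1)
        smooth_on_linear_compose[OF S1(1) bounded_linear_transpose M])
  \<comment> \<open>The second root must also lie in \<open>U\<close>: \<open>N z\<close> squares to
    \<open>T z\<close>, and only there does equality of squares give
    \<open>N z = M z\<close>.\<close>
  define S' where "S' = S1 \<inter> N -` U"
  have S': "open S'" "S' \<subseteq> S1" "z0 \<in> S'"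
    using continuous_open_preimage[OF smooth_on_continuous_on[OF N] S1(1) UV(1)] S1(3) UV(2)
    by (auto simp: S'_def N_def M0 transpose_mat EE)
  define P where "P = (\<lambda>z. M z ** C)"
  show ?thesis
  proof (rule that[of S' P])
    show "smooth_on P S'"
      unfolding P_def
      by (intro smooth_on_bilinear[OF S'(1) bounded_bilinear_matrix_mult] smooth_on_const S'(1)
          smooth_on_subset[OF M S'(2)])
    show "P z0 = C" by (simp add: P_def M0)
    fix z assume z: "z \<in> S'"
    then have zS: "z \<in> S" "T z \<in> V" "N z \<in> U" using S1 S' by (auto simp: S'_def S1_def)
    have MM: "M z ** M z = T z" by (simp add: M_def R2 zS)
    have "N z ** N z = ?E ** transpose (M z) ** (?E ** ?E) ** transpose (M z) ** ?E"
      by (simp only: N_def matrix_mul_assoc)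
    also have "\<dots> = ?E ** transpose (M z ** M z) ** ?E"
      by (simp add: EE matrix_transpose_mul matrix_mul_assoc)
    also have "\<dots> = ?E ** Q' z ** (?E ** ?E)"
      by (simp add: MM T_def matrix_transpose_mul transpose_diag Q'_sym[OF zS(1)] matrix_mul_assoc)
    finally have NN: "N z ** N z = T z" by (simp add: EE T_def)
    have "N z = M z"
      using R[OF zS(3)] by (simp add: NN M_def)
    then have "?E ** M z = ?E ** (?E ** transpose (M z) ** ?E)"
      by (simp only: N_def)
    also have "\<dots> = ?E ** ?E ** transpose (M z) ** ?E"
      by (simp only: matrix_mul_assoc)
    finally have ME: "transpose (M z) ** ?E = ?E ** M z" by (simp add: EE)
    have "transpose (P z) ** ?E ** P z = transpose C ** (transpose (M z) ** ?E) ** M z ** C"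
      by (simp add: P_def matrix_transpose_mul matrix_mul_assoc)
    also have "\<dots> = transpose C ** ?E ** (M z ** M z) ** C"
      by (simp add: ME matrix_mul_assoc)
    also have "\<dots> = transpose C ** (?E ** ?E) ** Q' z ** C"
      by (simp add: MM T_def matrix_mul_assoc)
    also have "\<dots> = (transpose C ** transpose Ci) ** Q z ** (Ci ** C)"
      by (simp only: EE Q'_def matrix_mul_assoc matrix_mul_rid)
    finally show "Q z = transpose (P z) ** ?E ** P z" by (simp add: Ci CiT)
  qed (use S1 S' in auto)
qed

text \<open>In the product rule for \<open>P z *v u z\<close> at \<open>z0\<close> the derivative of
  \<open>P\<close> is applied to \<open>u z0 = 0\<close>. What remains is \<open>C\<close> after
  \<open>D\<close>, which is invertible, so the smooth inverse function theorem applies.\<close>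

lemma quadratic_form_normal_coordinates:
  fixes u :: "'v::euclidean_space \<Rightarrow> real^'k::finite" and Q :: "'v \<Rightarrow> real^'k^'k"
  assumes S: "open S" "z0 \<in> S"
    and u: "smooth_on u S" "u z0 = 0" "(u has_derivative D) (at z0)"
    and L: "bounded_linear L" "\<And>v. L (D v) = v" "\<And>w. D (L w) = w"
    and Q: "smooth_on Q S" "\<And>z. z \<in> S \<Longrightarrow> transpose (Q z) = Q z"
    and s: "\<And>i. s i = 1 \<or> s i = - 1"
    and C: "invertible C" "Q z0 = transpose C ** diag s ** C"
  obtains T and X :: "'v \<Rightarrow> real^'k" and G where "open T" "T \<subseteq> S" "z0 \<in> T" "open (X ` T)" "homeomorphism T (X ` T) X G"
    "smooth_on X T" "smooth_on G (X ` T)"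
    "\<And>z. z \<in> T \<Longrightarrow> u z \<bullet> (Q z *v u z) = (\<Sum>i\<in>UNIV. s i * (X z $ i)\<^sup>2)"
proof -
  obtain S' P where P: "open S'" "S' \<subseteq> S" "z0 \<in> S'" "smooth_on P S'" "P z0 = C"
    "\<And>z. z \<in> S' \<Longrightarrow> Q z = transpose (P z) ** diag s ** P z"
    using smooth_symmetric_congruence[OF S Q s C] by metis
  define Ci where "Ci = matrix_inv C"
  have Ci: "C ** Ci = mat 1" "Ci ** C = mat 1"
    using C(1) unfolding Ci_def by (simp_all add: matrix_inv_right matrix_inv_left)
  define X where "X = (\<lambda>z. P z *v u z)"
  have X: "smooth_on X S'"
    unfolding X_def
    by (intro smooth_on_bilinear[OF P(1) bounded_bilinear_matrix_vector_mult] P(4) smooth_on_subset[OF u(1) P(2)])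
  obtain DP where DP: "\<And>z. z \<in> S' \<Longrightarrow> (P has_derivative DP z) (at z)"
    using smooth_onE[OF P(1,4)] by metis
  have DX: "(X has_derivative (\<lambda>h. C *v D h)) (at z0)"
    using bounded_bilinear.FDERIV[OF bounded_bilinear_matrix_vector_mult DP[OF P(3)] u(3)]
    by (simp add: X_def u(2) P(5))
  have "bounded_linear (\<lambda>w. L (Ci *v w))"
    by (rule bounded_linear_compose[OF L(1) matrix_vector_mul_bounded_linear])
  then obtain T V G where T: "open T" "T \<subseteq> S'" "z0 \<in> T" "open V" "homeomorphism T V X G" "smooth_on G V"
    by (rule smooth_inverse_function[OF P(1,3) X DX])
      (simp_all add: L Ci matrix_vector_mul_assoc)
  have V: "X ` T = V" using T(5) by (simp add: homeomorphism_def)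
  show ?thesis
  proof (rule that[of T X G, unfolded V])
    fix z assume "z \<in> T"
    then have "Q z = transpose (P z) ** diag s ** P z" using P(6) T(2) by blast
    then have "u z \<bullet> (Q z *v u z) = u z \<bullet> (transpose (P z) *v (diag s *v X z))"
      by (simp add: X_def matrix_vector_mul_assoc matrix_mul_assoc)
    also have "\<dots> = X z \<bullet> (diag s *v X z)"
      using dot_lmul_matrix[of "diag s *v X z" "P z" "u z"]
      by (simp add: transpose_matrix_vector inner_commute X_def)
    also have "\<dots> = (\<Sum>i\<in>UNIV. s i * (X z $ i)\<^sup>2)"
      by (simp add: diag_mult_vec inner_vec_def power2_eq_square mult_ac)
    finally show "u z \<bullet> (Q z *v u z) = (\<Sum>i\<in>UNIV. s i * (X z $ i)\<^sup>2)" .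
  qed (use T P smooth_on_subset[OF X] in auto)
qed

text \<open>Every term that leaves a factor \<open>u\<close> undifferentiated dies at
  \<open>z0\<close>, so neither second derivatives of \<open>u\<close> nor derivatives of
  \<open>Q\<close> survive. The two remaining terms agree by symmetry of \<open>Q\<close>, whence
  the factor 2.\<close>

lemma second_derivative_quadratic_form:
  fixes u :: "'v::euclidean_space \<Rightarrow> real^'k::finite" and Q :: "'v \<Rightarrow> real^'k^'k"
  assumes S: "open S" "z0 \<in> S"
    and u: "smooth_on u S" "u z0 = 0" "(u has_derivative D) (at z0)"
    and Q: "smooth_on Q S" "\<And>z. z \<in> S \<Longrightarrow> transpose (Q z) = Q z"
    and f: "\<And>z. z \<in> S \<Longrightarrow> f z = u z \<bullet> (Q z *v u z)"
  shows "partial_derivative b f z0 = 0"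
    and "partial_derivative a (partial_derivative b f) z0 = 2 * (D b \<bullet> (Q z0 *v D a))"
proof -
  obtain Du where Du: "\<And>z. z \<in> S \<Longrightarrow> (u has_derivative Du z) (at z)" "\<And>v. smooth_on (\<lambda>z. Du z v) S"
    using smooth_onE[OF S(1) u(1)] by blast
  obtain DQ where DQ: "\<And>z. z \<in> S \<Longrightarrow> (Q has_derivative DQ z) (at z)" "\<And>v. smooth_on (\<lambda>z. DQ z v) S"
    using smooth_onE[OF S(1) Q(1)] by blast
  note mv = bounded_bilinear.FDERIV[OF bounded_bilinear_matrix_vector_mult]
  have sym: "x \<bullet> (Q z *v y) = y \<bullet> (Q z *v x)" if "z \<in> S" for x y z
    using Q(2)[OF that] by (metis dot_lmul_matrix inner_commute transpose_matrix_vector)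
  have f': "partial_derivative b f z = 2 * (Du z b \<bullet> (Q z *v u z)) + u z \<bullet> (DQ z b *v u z)"
    if z: "z \<in> S" for z b
  proof -
    have "((\<lambda>z. u z \<bullet> (Q z *v u z)) has_derivative
        (\<lambda>h. u z \<bullet> (Q z *v Du z h + DQ z h *v u z) + Du z h \<bullet> (Q z *v u z))) (at z)"
      by (rule has_derivative_inner[OF Du(1)[OF z] mv[OF DQ(1)[OF z] Du(1)[OF z]]])
    then have "partial_derivative b (\<lambda>z. u z \<bullet> (Q z *v u z)) z =
        u z \<bullet> (Q z *v Du z b + DQ z b *v u z) + Du z b \<bullet> (Q z *v u z)"
      by (rule partial_derivative_eq)
    moreover have "partial_derivative b f z = partial_derivative b (\<lambda>z. u z \<bullet> (Q z *v u z)) z"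
      by (rule partial_derivative_cong[OF S(1) z f])
    ultimately show ?thesis
      using sym[OF z, of "u z" "Du z b"] by (simp add: inner_add_right)
  qed
  show "partial_derivative b f z0 = 0"
    by (simp add: f'[OF S(2)] u(2))
  have D: "Du z0 = D"
    using has_derivative_unique[OF Du(1)[OF S(2)] u(3)] .
  obtain E1 where E1: "((\<lambda>z. Du z b) has_derivative E1) (at z0)"
    using smooth_onE[OF S(1) Du(2)] S(2) by metis
  obtain E2 where E2: "((\<lambda>z. DQ z b) has_derivative E2) (at z0)"
    using smooth_onE[OF S(1) DQ(2)] S(2) by metis
  have "((\<lambda>z. 2 * (Du z b \<bullet> (Q z *v u z)) + u z \<bullet> (DQ z b *v u z)) has_derivative
      (\<lambda>h. 2 * (D b \<bullet> (Q z0 *v D h)))) (at z0)"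
    using has_derivative_add[OF
        has_derivative_mult_right[OF has_derivative_inner[OF E1 mv[OF DQ(1)[OF S(2)] u(3)]], of 2]
        has_derivative_inner[OF u(3) mv[OF E2 u(3)]]]
    by (simp add: u(2) D)
  from partial_derivative_eq[OF this, of a]
  show "partial_derivative a (partial_derivative b f) z0 = 2 * (D b \<bullet> (Q z0 *v D a))"
    using partial_derivative_cong[OF S f'] by simp
qed

section \<open>Normal form at a nondegenerate critical point\<close>

definition real_coords :: "complex^'n::finite \<Rightarrow> real^('n + 'n)" where
  "real_coords z = (\<chi> a. case a of Inl i \<Rightarrow> Re (z $ i) | Inr i \<Rightarrow> Im (z $ i))"

definition complex_coords :: "real^('n::finite + 'n) \<Rightarrow> complex^'n" where
  "complex_coords v = (\<chi> i. Complex (v $ Inl i) (v $ Inr i))"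

lemma real_coords_complex_coords [simp]: "real_coords (complex_coords v) = v"
  by (auto simp: real_coords_def complex_coords_def vec_eq_iff split: sum.split)

lemma complex_coords_real_coords [simp]: "complex_coords (real_coords z) = z"
  by (auto simp: real_coords_def complex_coords_def vec_eq_iff complex_eq_iff)

lemma linear_real_coords: "linear real_coords"
  by (rule linearI) (auto simp: real_coords_def vec_eq_iff split: sum.split)

lemma linear_complex_coords: "linear complex_coords"
  by (rule linearI) (auto simp: complex_coords_def vec_eq_iff complex_eq_iff)

lemma complex_coords_axis: "complex_coords (axis a 1) = real_axis a"
  by (auto simp: complex_coords_def real_axis_def axis_def vec_eq_iff complex_eq_iff split: sum.split)

lemma complex_coords_expansion: "complex_coords v = (\<Sum>a\<in>UNIV. v $ a *\<^sub>R real_axis a)"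
proof -
  have "complex_coords (\<Sum>a\<in>UNIV. v $ a *\<^sub>R axis a 1) = (\<Sum>a\<in>UNIV. v $ a *\<^sub>R real_axis a)"
    by (simp add: linear_sum[OF linear_complex_coords] linear_scale[OF linear_complex_coords] complex_coords_axis)
  then show ?thesis
    using basis_expansion[of v] by (simp add: scalar_mult_eq_scaleR)
qed

lemma matrix_component: "(M :: real^'k::finite^'k) $ a $ b = axis a 1 \<bullet> (M *v axis b 1)"
  by (simp add: inner_axis' matrix_vector_mult_basis column_def)

lemma transpose_scaleR: "transpose (c *\<^sub>R A) = c *\<^sub>R transpose (A :: 'a::real_vector^'m^'n)"
  by (simp add: transpose_def vec_eq_iff)

lemma invertible_scaleR:
  assumes "c \<noteq> 0"
  shows "invertible (c *\<^sub>R A :: real^'k::finite^'k) \<longleftrightarrow> invertible A"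
proof -
  interpret mm: bounded_bilinear "(**) :: real^'k^'k \<Rightarrow> real^'k^'k \<Rightarrow> real^'k^'k"
    by (rule bounded_bilinear_matrix_mult)
  have *: "invertible (c *\<^sub>R A)" if "invertible A" "c \<noteq> 0" for c and A :: "real^'k^'k"
  proof -
    have "(inverse c *\<^sub>R matrix_inv A) ** (c *\<^sub>R A) = mat 1"
      using that by (simp add: mm.scaleR_left mm.scaleR_right matrix_inv_left)
    then show ?thesis unfolding invertible_left_inverse by blast
  qed
  show ?thesis
    using *[of A c] *[of "c *\<^sub>R A" "inverse c"] assms by auto
qed

text \<open>The signs must come from the Hessian, whose eigenvalues the Morse index counts, whereas
  the square root argument needs a normal form of \<open>Q z0\<close>. The congruence between the
  two matrices carries the same \<open>s\<close> across, so no law of inertia has to be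
  invoked.\<close>

theorem morse_normal_form:
  fixes u :: "complex^'n::finite \<Rightarrow> real^('n + 'n)" and f :: "complex^'n \<Rightarrow> real"
  assumes S: "open S" "z0 \<in> S"
    and u: "smooth_on u S" "u z0 = 0"
    and Q: "smooth_on Q S" "\<And>z. z \<in> S \<Longrightarrow> transpose (Q z) = Q z"
    and f: "\<And>z. z \<in> S \<Longrightarrow> f z = u z \<bullet> (Q z *v u z)"
    and H: "invertible (hessian f z0)"
  obtains s T and X :: "complex^'n \<Rightarrow> real^('n + 'n)" and G where
    "\<And>b. partial_derivative b f z0 = 0" "\<And>i. s i = 1 \<or> s i = - 1"
    "\<And>c. c > 0 \<Longrightarrow> negative_eigenvalue_count (c *\<^sub>R hessian f z0) = card {i. s i = - 1}"
    "\<And>c. c < 0 \<Longrightarrow> negative_eigenvalue_count (c *\<^sub>R hessian f z0) = 2 * CARD('n) - card {i. s i = - 1}"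
    "open T" "T \<subseteq> S" "z0 \<in> T" "open (X ` T)" "homeomorphism T (X ` T) X G"
    "smooth_on X T" "smooth_on G (X ` T)"
    "\<And>z. z \<in> T \<Longrightarrow> f z = (\<Sum>i\<in>UNIV. s i * (X z $ i)\<^sup>2)"
proof -
  interpret mm: bounded_bilinear "(**) :: real^('n + 'n)^('n + 'n) \<Rightarrow> real^('n + 'n)^('n + 'n) \<Rightarrow> real^('n + 'n)^('n + 'n)"
    by (rule bounded_bilinear_matrix_mult)
  obtain Du where Du: "\<And>z. z \<in> S \<Longrightarrow> (u has_derivative Du z) (at z)"
    "\<And>v. smooth_on (\<lambda>z. Du z v) S"
    using smooth_onE[OF S(1) u(1)] by blast
  define D where "D = Du z0"
  have D: "(u has_derivative D) (at z0)" using Du(1)[OF S(2)] by (simp add: D_def)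
  have D_lin: "linear D" using D by (rule has_derivative_linear)
  note deriv = second_derivative_quadratic_form[OF S u D Q f]
  define B where "B = matrix (\<lambda>w. D (complex_coords w))"
  have B: "B *v w = D (complex_coords w)" for w
    using matrix_vector_mul(2)[OF linear_compose[OF linear_complex_coords D_lin]]
    by (simp add: B_def o_def fun_eq_iff)
  let ?H = "hessian f z0"
  have H_eq: "?H = 2 *\<^sub>R (transpose B ** Q z0 ** B)"
  proof (simp only: vec_eq_iff, intro allI)
    fix a b
    have "?H $ a $ b = 2 * (D (real_axis b) \<bullet> (Q z0 *v D (real_axis a)))"
      by (simp add: hessian_def deriv(2))
    also have "\<dots> = 2 * (D (real_axis a) \<bullet> (Q z0 *v D (real_axis b)))"
      using Q(2)[OF S(2)] by (metis dot_lmul_matrix inner_commute transpose_matrix_vector)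
    also have "\<dots> = 2 * ((B *v axis a 1) \<bullet> (Q z0 *v (B *v axis b 1)))"
      by (simp add: B complex_coords_axis)
    also have "\<dots> = 2 * (axis a 1 \<bullet> ((transpose B ** Q z0 ** B) *v axis b 1))"
      using dot_lmul_matrix[of "Q z0 *v (B *v axis b 1)" B "axis a 1"]
      by (simp only: transpose_matrix_vector matrix_vector_mul_assoc[symmetric] inner_commute)
    finally show "?H $ a $ b = (2 *\<^sub>R (transpose B ** Q z0 ** B)) $ a $ b"
      by (simp add: matrix_component[of "transpose B ** Q z0 ** B"])
  qed
  have H_sym: "transpose ?H = ?H"
    unfolding H_eq
    by (simp add: transpose_scaleR matrix_transpose_mul Q(2)[OF S(2)] matrix_mul_assoc)
  \<comment> \<open>As \<open>B\<close> is the last factor of the invertible \<open>?H\<close>, it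
    has a left inverse.\<close>
  have "(matrix_inv ?H ** (2 *\<^sub>R (transpose B ** Q z0))) ** B = matrix_inv ?H ** ?H"
    by (simp add: H_eq mm.scaleR_left mm.scaleR_right matrix_mul_assoc)
  then have "invertible B"
    unfolding invertible_left_inverse using matrix_inv_left[OF H] by metis
  define Bi where "Bi = matrix_inv B"
  have Bi: "B ** Bi = mat 1" "Bi ** B = mat 1"
    using \<open>invertible B\<close> by (simp_all add: Bi_def matrix_inv_left matrix_inv_right)
  have BiT: "transpose Bi ** transpose B = mat 1"
    by (metis Bi(1) matrix_transpose_mul transpose_mat)
  obtain P :: "real^('n + 'n)^('n + 'n)" and s where P: "invertible P" and s: "\<And>i. s i = 1 \<or> s i = - 1"
    and HP: "?H = transpose P ** diag s ** P"
    and cnt: "\<And>c. c > 0 \<Longrightarrow> negative_eigenvalue_count (c *\<^sub>R ?H) = card {i. s i = - 1}"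
    "\<And>c. c < 0 \<Longrightarrow> negative_eigenvalue_count (c *\<^sub>R ?H) = CARD('n + 'n) - card {i. s i = - 1}"
    using nondegenerate_symmetric_matrix_normal_form[OF H_sym H] by blast
  \<comment> \<open>\<open>C\<close> is found by solving 2 B^T Q B = P^T diag(s) P for
    \<open>Q z0\<close>; the square root of 2 absorbs the factor 2 of the Hessian.\<close>
  define C where "C = (1 / sqrt 2) *\<^sub>R (P ** Bi)"
  have "(B ** matrix_inv P) ** (P ** Bi) = B ** (matrix_inv P ** P) ** Bi"
    by (simp only: matrix_mul_assoc)
  then have "invertible (P ** Bi)"
    unfolding invertible_left_inverse[of "P ** Bi"] using P Bi by (auto simp: matrix_inv_left)
  then have C: "invertible C"
    unfolding C_def by (subst invertible_scaleR) auto
  have "transpose C = (1 / sqrt 2) *\<^sub>R (transpose Bi ** transpose P)"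
    unfolding C_def
    by (simp add: transpose_scaleR matrix_transpose_mul)
  then have "transpose C ** diag s ** C = (1 / 2) *\<^sub>R (transpose Bi ** transpose P ** diag s ** (P ** Bi))"
    by (simp add: C_def mm.scaleR_left mm.scaleR_right)
  also have "\<dots> = (1 / 2) *\<^sub>R (transpose Bi ** ?H ** Bi)"
    by (simp only: HP matrix_mul_assoc)
  also have "\<dots> = (transpose Bi ** transpose B) ** Q z0 ** (B ** Bi)"
    by (simp add: H_eq mm.scaleR_left mm.scaleR_right matrix_mul_assoc)
  also have "\<dots> = Q z0" by (simp add: BiT Bi)
  finally have QC: "Q z0 = transpose C ** diag s ** C" by simp
  have L: "bounded_linear (\<lambda>w. complex_coords (Bi *v w))"
    unfolding linear_conv_bounded_linear[symmetric]
    by (rule linear_compose[OF matrix_vector_mul_linear linear_complex_coords, unfolded o_def])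
  have LD: "complex_coords (Bi *v D v) = v" for v
  proof -
    have "Bi *v (B *v real_coords v) = real_coords v"
      by (simp add: matrix_vector_mul_assoc Bi)
    then show ?thesis by (simp add: B)
  qed
  have DL: "D (complex_coords (Bi *v w)) = w" for w
    by (simp add: B[symmetric] matrix_vector_mul_assoc Bi)
  obtain T X G where "open T" "T \<subseteq> S" "z0 \<in> T" "open (X ` T)" "homeomorphism T (X ` T) X G"
    "smooth_on X T" "smooth_on G (X ` T)"
    "\<And>z. z \<in> T \<Longrightarrow> u z \<bullet> (Q z *v u z) = (\<Sum>i\<in>UNIV. s i * (X z $ i)\<^sup>2)"
    using quadratic_form_normal_coordinates[OF S u D L LD DL Q s C QC] by blast
  note T = this
  have fT: "f z = (\<Sum>i\<in>UNIV. s i * (X z $ i)\<^sup>2)" if "z \<in> T" for z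
    using T(8)[OF that] f[of z] T(2) that by auto
  have "CARD('n + 'n) = 2 * CARD('n)" by simp
  then show ?thesis
    using that[OF deriv(1) s cnt(1) _ T(1-7) fT] cnt(2) by simp
qed

section \<open>Real quadratic forms from sesquilinear ones\<close>

definition hermitian_form :: "complex^'n^'n::finite \<Rightarrow> complex^'n \<Rightarrow> complex^'n \<Rightarrow> real" where
  "hermitian_form G x y = Re (\<Sum>i\<in>UNIV. \<Sum>j\<in>UNIV. G $ i $ j * x $ i * cnj (y $ j))"

text \<open>Averaging over the two orders of arguments makes the matrix symmetric for every
  \<open>G\<close> and does not change the values on the diagonal, which are all that the potential
  uses.\<close>

definition real_form :: "complex^'n^'n::finite \<Rightarrow> real^('n + 'n)^('n + 'n)" where
  "real_form G = (\<chi> a b. (hermitian_form G (real_axis a) (real_axis b)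
    + hermitian_form G (real_axis b) (real_axis a)) / 2)"

lemma transpose_real_form: "transpose (real_form G) = real_form G"
  by (simp add: real_form_def transpose_def vec_eq_iff add.commute)

lemma linear_hermitian_form: "linear (\<lambda>G. hermitian_form G x y)"
  by (rule linearI)
    (simp_all add: hermitian_form_def algebra_simps sum.distrib sum_distrib_left scaleR_sum_right)

lemma bounded_linear_real_form: "bounded_linear real_form"
  unfolding linear_conv_bounded_linear[symmetric]
  by (rule linearI)
    (simp_all add: real_form_def vec_eq_iff linear_add[OF linear_hermitian_form]
      linear_scale[OF linear_hermitian_form] field_simps)

lemma bilinear_hermitian_form: "bilinear (hermitian_form G)"
  unfolding bilinear_def hermitian_form_def
  by (auto intro!: linearI simp: algebra_simps sum.distrib sum_subtractf scaleR_sum_right sum_distrib_left)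

text \<open>Expanding \<open>w\<close> along the real axes gives a double sum, and exchanging its
  two indices shows that both halves of the average have the value of the form at
  \<open>w\<close>.\<close>

lemma hermitian_form_real_form:
  "hermitian_form G w w = real_coords w \<bullet> (real_form G *v real_coords w)"
proof -
  define x where "x = real_coords w"
  let ?q = "hermitian_form G"
  have "w = (\<Sum>a\<in>UNIV. x $ a *\<^sub>R real_axis a)"
    using complex_coords_expansion[of x] by (simp add: x_def)
  then have "?q w w = (\<Sum>a\<in>UNIV. \<Sum>b\<in>UNIV. ?q (x $ a *\<^sub>R real_axis a) (x $ b *\<^sub>R real_axis b))"
    by (simp add: bilinear_sum[OF bilinear_hermitian_form] sum.cartesian_product)
  then have 1: "?q w w = (\<Sum>a\<in>UNIV. \<Sum>b\<in>UNIV. x $ a * x $ b * ?q (real_axis a) (real_axis b))"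
    by (simp add: bilinear_lmul[OF bilinear_hermitian_form] bilinear_rmul[OF bilinear_hermitian_form] mult_ac)
  also have "\<dots> = (\<Sum>a\<in>UNIV. \<Sum>b\<in>UNIV. x $ a * x $ b * ?q (real_axis b) (real_axis a))"
    by (subst sum.swap) (simp add: mult_ac)
  finally have 2: "?q w w = (\<Sum>a\<in>UNIV. \<Sum>b\<in>UNIV. x $ a * x $ b * ?q (real_axis b) (real_axis a))" .
  have "x \<bullet> (real_form G *v x) = (\<Sum>a\<in>UNIV. \<Sum>b\<in>UNIV. x $ a * x $ b * real_form G $ a $ b)"
    by (simp add: inner_vec_def matrix_vector_mult_def sum_distrib_left mult_ac)
  also have "\<dots> = ((\<Sum>a\<in>UNIV. \<Sum>b\<in>UNIV. x $ a * x $ b * ?q (real_axis a) (real_axis b))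
      + (\<Sum>a\<in>UNIV. \<Sum>b\<in>UNIV. x $ a * x $ b * ?q (real_axis b) (real_axis a))) / 2"
    by (simp add: real_form_def sum.distrib[symmetric] sum_divide_distrib distrib_left)
  also have "\<dots> = ?q w w" using 1 2 by simp
  finally show ?thesis by (simp add: x_def)
qed

section \<open>Smoothness of vectors, Wirtinger derivatives and matrix inverses\<close>

lemma smooth_on_vec_lambda:
  fixes f :: "'i::finite \<Rightarrow> 'v::euclidean_space \<Rightarrow> 'w::euclidean_space"
  assumes "open S" "\<And>i. smooth_on (f i) S"
  shows "smooth_on (\<lambda>x. \<chi> i. f i x) S"
proof (rule smooth_on_transform[OF assms(1)])
  have "linear (axis i :: 'w \<Rightarrow> 'w^'i)" for i
    by (rule linearI) (auto simp: axis_def vec_eq_iff)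
  then have "bounded_linear (axis i :: 'w \<Rightarrow> 'w^'i)" for i
    by (simp add: linear_conv_bounded_linear)
  from smooth_on_linear_compose[OF assms(1) this assms(2)]
  show "smooth_on (\<lambda>x. \<Sum>i\<in>UNIV. axis i (f i x)) S"
    by (intro smooth_on_sum assms(1))
  show "(\<Sum>i\<in>UNIV. axis i (f i x)) = (\<chi> i. f i x)" for x
    by (simp add: vec_eq_iff axis_def)
qed

lemma smooth_on_wirtinger:
  assumes "open S" "smooth_on f S"
  shows "smooth_on (wirtinger i f) S" "smooth_on (wirtinger_bar i f) S"
proof -
  have p: "smooth_on (partial_derivative v f) S" for v
    by (rule smooth_on_partial_derivative[OF assms])
  have "smooth_on (\<lambda>z. (1/2) * partial_derivative (axis i 1) f z + c * partial_derivative (axis i \<i>) f z) S" for c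
    by (intro smooth_on_add smooth_on_linear_compose[OF _ bounded_linear_mult_right] p assms(1))
  note comb = this
  show "smooth_on (wirtinger i f) S"
    by (rule smooth_on_transform[OF assms(1) comb[of "- \<i> / 2"]]) (simp add: wirtinger_def field_simps)
  show "smooth_on (wirtinger_bar i f) S"
    by (rule smooth_on_transform[OF assms(1) comb[of "\<i> / 2"]]) (simp add: wirtinger_bar_def field_simps)
qed

lemma matrix_inv_eqI: "A ** B = mat 1 \<Longrightarrow> B ** A = mat 1 \<Longrightarrow> matrix_inv A = B"
  by (metis invertible_def matrix_inv_left matrix_mul_assoc matrix_mul_lid matrix_mul_rid)

lemma smooth_on_matrix_inv:
  fixes A :: "'v::euclidean_space \<Rightarrow> complex^'n^'n::finite"
  assumes "open S" "smooth_on A S" "\<And>z. z \<in> S \<Longrightarrow> invertible (A z)"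
  shows "smooth_on (\<lambda>z. matrix_inv (A z)) S"
  by (rule smooth_on_bilinear_inverse[OF bounded_bilinear_matrix_mult _ _ _ assms(1,2)])
    (auto simp: matrix_mul_assoc matrix_inv_left matrix_inv_right assms(3))

section \<open>Coordinates on the manifold\<close>

lemma local_coordinates_open_image:
  assumes "local_coordinates M U \<phi>" "openin M V" "V \<subseteq> U"
  shows "open (\<phi> ` V)"
proof -
  have hom: "homeomorphic_map (subtopology M U) (top_of_set (\<phi> ` U)) \<phi>"
    and "openin M U" "open (\<phi> ` U)"
    using assms(1) by (auto simp: local_coordinates_def)
  have top: "topspace (subtopology M U) = U"
    using openin_subset[OF \<open>openin M U\<close>] by auto
  have "openin (subtopology M U) V"
    using assms(2,3) \<open>openin M U\<close> by (simp add: openin_open_subtopology)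
  then have "openin (top_of_set (\<phi> ` U)) (\<phi> ` V)"
    using homeomorphic_map_openness[OF hom, of V] assms(3) unfolding top by simp
  then show ?thesis
    using \<open>open (\<phi> ` U)\<close> by (simp add: openin_open_eq)
qed

lemma local_coordinates_inj_on: "local_coordinates M U \<phi> \<Longrightarrow> inj_on \<phi> U"
  unfolding local_coordinates_def
  using openin_subset[of M U] homeomorphic_imp_injective_map[of "subtopology M U" _ \<phi>]
  by (auto simp: Int_absorb1)

lemma local_coordinates_openin_preimage:
  assumes "local_coordinates M U \<phi>" "open T" "T \<subseteq> \<phi> ` U"
  shows "openin M {p \<in> U. \<phi> p \<in> T}"
proof -
  have hom: "homeomorphic_map (subtopology M U) (top_of_set (\<phi> ` U)) \<phi>" and "openin M U"
    using assms(1) by (auto simp: local_coordinates_def)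
  have top: "topspace (subtopology M U) = U"
    using openin_subset[OF \<open>openin M U\<close>] by auto
  have "\<phi> ` {p \<in> U. \<phi> p \<in> T} = T" using assms(3) by auto
  then have "openin (top_of_set (\<phi> ` U)) (\<phi> ` {p \<in> U. \<phi> p \<in> T})"
    using assms(2,3) by (simp add: open_subset)
  then have "openin (subtopology M U) {p \<in> U. \<phi> p \<in> T}"
    using homeomorphic_map_openness[OF hom, of "{p \<in> U. \<phi> p \<in> T}"] top by auto
  then show ?thesis
    using \<open>openin M U\<close> by (simp add: openin_open_subtopology)
qed

lemma local_coordinates_compose:
  assumes "local_coordinates M U \<phi>" and T: "open T" "T \<subseteq> \<phi> ` U"
    and X: "homeomorphism T (X ` T) X G" "open (X ` T)"
  shows "local_coordinates M {p \<in> U. \<phi> p \<in> T} (\<lambda>p. X (\<phi> p))"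
proof -
  let ?N = "{p \<in> U. \<phi> p \<in> T}"
  have hom: "homeomorphic_map (subtopology M U) (top_of_set (\<phi> ` U)) \<phi>" and U: "openin M U"
    using assms(1) by (auto simp: local_coordinates_def)
  have N: "openin M ?N"
    by (rule local_coordinates_openin_preimage[OF assms(1) T])
  have img: "\<phi> ` ?N = T" using T(2) by auto
  have "homeomorphic_map (subtopology (subtopology M U) ?N) (subtopology (top_of_set (\<phi> ` U)) T) \<phi>"
    by (rule homeomorphic_map_subtopologies[OF hom])
      (use openin_subset[OF U] T(2) in auto)
  moreover have "U \<inter> ?N = ?N" "\<phi> ` U \<inter> T = T" using T(2) by auto
  ultimately have 1: "homeomorphic_map (subtopology M ?N) (top_of_set T) \<phi>"
    by (simp only: subtopology_subtopology)
  have 2: "homeomorphic_map (top_of_set T) (top_of_set (X ` T)) X"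
    unfolding homeomorphic_map_maps homeomorphic_maps_def
    by (rule exI[of _ G]) (use X(1) in \<open>auto simp: homeomorphism_def\<close>)
  have "(\<lambda>p. X (\<phi> p)) ` ?N = X ` \<phi> ` ?N" by (simp only: image_image)
  also have "\<dots> = X ` T" by (simp only: img)
  finally show ?thesis
    using homeomorphic_map_compose[OF 1 2] N X(2) by (simp add: local_coordinates_def o_def)
qed

lemma transition_smooth_on:
  fixes A :: "('a, 'n::finite) chart set"
  assumes M: "complex_manifold M A" and "(U, \<phi>) \<in> A" "(U', \<phi>') \<in> A"
  shows "smooth_on (\<lambda>z. \<phi>' (inv_into U \<phi> z)) (\<phi> ` (U \<inter> U'))"
proof -
  have lc: "local_coordinates M U \<phi>" "local_coordinates M U' \<phi>'"
    using assms unfolding complex_manifold_def by blast+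
  then have "openin M (U \<inter> U')" by (auto simp: local_coordinates_def intro: openin_Int)
  then have op: "open (\<phi> ` (U \<inter> U'))"
    by (intro local_coordinates_open_image[OF lc(1)]) auto
  have "multi_holomorphic_on (\<lambda>z. \<phi>' (inv_into U \<phi> z) $ k) (\<phi> ` (U \<inter> U'))" for k
    using assms unfolding complex_manifold_def by blast
  from smooth_on_vec_lambda[OF op, of "\<lambda>k z. \<phi>' (inv_into U \<phi> z) $ k", OF multi_holomorphic_smooth_on[OF op this]]
  show ?thesis by simp
qed

text \<open>Smoothness has to hold against every chart of the atlas, not only the one in which
  \<open>X\<close> was built. Passing to another chart inserts a transition map, which is
  holomorphic and therefore smooth.\<close>

theorem real_coordinates_compose:
  fixes A :: "('a, 'n::finite) chart set" and X :: "complex^'n \<Rightarrow> real^('n + 'n)"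
  assumes M: "complex_manifold M A" and c: "(U, \<phi>) \<in> A"
    and T: "open T" "T \<subseteq> \<phi> ` U"
    and X: "homeomorphism T (X ` T) X G" "open (X ` T)" "smooth_on X T" "smooth_on G (X ` T)"
  shows "real_coordinates M A {p \<in> U. \<phi> p \<in> T} (\<lambda>p. X (\<phi> p))"
proof -
  let ?N = "{p \<in> U. \<phi> p \<in> T}"
  have lc: "local_coordinates M U \<phi>"
    using M c unfolding complex_manifold_def by blast
  have lcN: "local_coordinates M ?N (\<lambda>p. X (\<phi> p))"
    by (rule local_coordinates_compose[OF lc T X(1,2)])
  note N = local_coordinates_openin_preimage[OF lc T]
  have G: "G (X z) = z" if "z \<in> T" for z
    using X(1) that by (simp add: homeomorphism_def)
  have "smooth_on (\<lambda>z. X (\<phi> (inv_into U' \<phi>' z))) (\<phi>' ` (U' \<inter> ?N)) \<and>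
      smooth_on (\<lambda>x. \<phi>' (inv_into ?N (\<lambda>p. X (\<phi> p)) x)) ((\<lambda>p. X (\<phi> p)) ` (U' \<inter> ?N))"
    if c': "(U', \<phi>') \<in> A" for U' \<phi>'
  proof
    have lc': "local_coordinates M U' \<phi>'"
      using M c' unfolding complex_manifold_def by blast
    have UN: "openin M (U' \<inter> ?N)"
      using lc' N by (auto simp: local_coordinates_def intro: openin_Int)
    have op1: "open (\<phi>' ` (U' \<inter> ?N))"
      by (rule local_coordinates_open_image[OF lc' UN]) auto
    have op2: "open ((\<lambda>p. X (\<phi> p)) ` (U' \<inter> ?N))"
      by (rule local_coordinates_open_image[OF lcN UN]) auto
    have op3: "open (\<phi> ` (U \<inter> U'))"
      using lc lc' by (intro local_coordinates_open_image[OF lc]) (auto simp: local_coordinates_def intro: openin_Int)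
    have inv': "inv_into U' \<phi>' (\<phi>' p) = p" if "p \<in> U'" for p
      using local_coordinates_inj_on[OF lc'] that by simp
    show "smooth_on (\<lambda>z. X (\<phi> (inv_into U' \<phi>' z))) (\<phi>' ` (U' \<inter> ?N))"
    proof (rule smooth_on_compose[OF op1 T(1) _ X(3)])
      show "smooth_on (\<lambda>z. \<phi> (inv_into U' \<phi>' z)) (\<phi>' ` (U' \<inter> ?N))"
        by (rule smooth_on_subset[OF transition_smooth_on[OF M c' c]]) auto
    qed (auto simp: inv')
    \<comment> \<open>The inverse of the composite map is replaced by \<open>G\<close> followed by
      the inverse chart; this is a transition map after \<open>G\<close>, and the two agree on the
      image.\<close>
    have "smooth_on (\<lambda>x. \<phi>' (inv_into U \<phi> (G x))) ((\<lambda>p. X (\<phi> p)) ` (U' \<inter> ?N))"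
    proof (rule smooth_on_compose[OF op2 op3 _ transition_smooth_on[OF M c c']])
      show "smooth_on G ((\<lambda>p. X (\<phi> p)) ` (U' \<inter> ?N))"
        by (rule smooth_on_subset[OF X(4)]) auto
    qed (auto simp: G)
    then show "smooth_on (\<lambda>x. \<phi>' (inv_into ?N (\<lambda>p. X (\<phi> p)) x)) ((\<lambda>p. X (\<phi> p)) ` (U' \<inter> ?N))"
    proof (rule smooth_on_transform[OF op2])
      fix x assume "x \<in> (\<lambda>p. X (\<phi> p)) ` (U' \<inter> ?N)"
      then obtain p where p: "p \<in> ?N" "x = X (\<phi> p)" by auto
      have "inv_into ?N (\<lambda>p. X (\<phi> p)) x = p"
        using inv_into_f_f[OF local_coordinates_inj_on[OF lcN] p(1)] p(2) by simp
      moreover have "inv_into U \<phi> (G x) = p"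
        using inv_into_f_f[OF local_coordinates_inj_on[OF lc]] p by (simp add: G)
      ultimately show "\<phi>' (inv_into U \<phi> (G x)) = \<phi>' (inv_into ?N (\<lambda>p. X (\<phi> p)) x)" by simp
    qed
  qed
  with lcN show ?thesis unfolding real_coordinates_def by blast
qed

text \<open>The scaling acts on the target only, so the domain \<open>T\<close> is the same for
  every c. With c = |\<sigma>|^(-1/2) this provides one neighbourhood for all times.\<close>

lemma scaled_coordinates:
  fixes X :: "'v::euclidean_space \<Rightarrow> 'w::euclidean_space"
  assumes "c \<noteq> (0 :: real)" "open T"
    and X: "homeomorphism T (X ` T) X G" "open (X ` T)" "smooth_on X T" "smooth_on G (X ` T)"
  defines "Y \<equiv> \<lambda>z. c *\<^sub>R X z"
  shows "homeomorphism T (Y ` T) Y (\<lambda>y. G (y /\<^sub>R c))" "open (Y ` T)"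
    "smooth_on Y T" "smooth_on (\<lambda>y. G (y /\<^sub>R c)) (Y ` T)"
proof -
  have img: "Y ` T = (*\<^sub>R) c ` X ` T" by (auto simp: Y_def)
  show op: "open (Y ` T)"
    unfolding img by (rule open_scaling[OF assms(1) X(2)])
  show "smooth_on Y T"
    unfolding Y_def by (rule smooth_on_linear_compose[OF assms(2) bounded_linear_scaleR_right X(3)])
  have sub: "(\<lambda>y. y /\<^sub>R c) ` Y ` T \<subseteq> X ` T"
    using assms(1) by (auto simp: Y_def)
  show "smooth_on (\<lambda>y. G (y /\<^sub>R c)) (Y ` T)"
    by (rule smooth_on_compose[OF op X(2) sub X(4) smooth_on_linear[OF op bounded_linear_scaleR_right]])
  have XG: "continuous_on (X ` T) G" "\<And>z. z \<in> T \<Longrightarrow> G (X z) = z"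
    using X(1) by (simp_all add: homeomorphism_def)
  show "homeomorphism T (Y ` T) Y (\<lambda>y. G (y /\<^sub>R c))"
  proof (rule homeomorphismI)
    show "continuous_on T Y"
      unfolding Y_def using X(1) by (intro continuous_intros) (simp add: homeomorphism_def)
    show "continuous_on (Y ` T) (\<lambda>y. G (y /\<^sub>R c))"
      by (rule continuous_on_compose2[OF XG(1) _ sub]) (intro continuous_intros)
  qed (use assms(1) XG(2) in \<open>auto simp: Y_def\<close>)
qed

section \<open>The scalar potential\<close>

lemma wirtinger_bar_cnj:
  assumes "f differentiable (at z)"
  shows "wirtinger_bar j (\<lambda>w. cnj (f w)) z = cnj (wirtinger j f z)"
proof -
  obtain D where D: "(f has_derivative D) (at z)"
    using assms by (auto simp: differentiable_def)
  have "((\<lambda>w. cnj (f w)) has_derivative (\<lambda>h. cnj (D h))) (at z)"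
    by (rule bounded_linear.has_derivative[OF bounded_linear_cnj D])
  then show ?thesis
    by (simp add: wirtinger_bar_def wirtinger_def partial_derivative_eq[OF D] partial_derivative_eq)
qed

text \<open>The components are second Wirtinger derivatives of a smooth potential; since the
  potential is only local, so is the conclusion.\<close>

lemma kaehler_metric_smooth_near:
  fixes A :: "('a, 'n::finite) chart set"
  assumes "kaehler_metric A g" "(U, \<phi>) \<in> A" "p \<in> U"
  obtains S where "open S" "\<phi> p \<in> S" "S \<subseteq> \<phi> ` U" "smooth_on (g (U, \<phi>)) S"
proof -
  obtain S and K :: "complex^'n \<Rightarrow> real" where S: "open S" "\<phi> p \<in> S" "S \<subseteq> \<phi> ` U" "smooth_on K S"
    and g: "\<And>z i j. z \<in> S \<Longrightarrow> g (U, \<phi>) z $ i $ j = wirtinger i (wirtinger_bar j (\<lambda>w. of_real (K w))) z"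
    using bspec[OF conjunct1[OF assms(1)[unfolded kaehler_metric_def]] assms(2)] assms(3) by auto
  have "smooth_on (\<lambda>w. complex_of_real (K w)) S"
    by (rule smooth_on_linear_compose[OF S(1) bounded_linear_of_real S(4)])
  then have "smooth_on (\<lambda>z. \<chi> i j. wirtinger i (wirtinger_bar j (\<lambda>w. complex_of_real (K w))) z) S"
    by (intro smooth_on_vec_lambda smooth_on_wirtinger S(1))
  then have "smooth_on (g (U, \<phi>)) S"
    by (rule smooth_on_transform[OF S(1)]) (simp add: vec_eq_iff g)
  with S that show ?thesis by blast
qed

lemma open_invertible:
  fixes h :: "'v::t2_space \<Rightarrow> complex^'n^'n::finite"
  assumes "open S" "continuous_on S h"
  shows "open {z \<in> S. invertible (h z)}"
proof -
  have "continuous_on S (\<lambda>z. h z $ i $ j)" for i j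
    by (intro continuous_on_component assms(2))
  then have "continuous_on S (\<lambda>z. det (h z))"
    unfolding det_def
    by (intro continuous_on_sum continuous_on_mult continuous_on_const continuous_on_prod)
  from continuous_open_preimage[OF this assms(1), of "- {0}"]
  have "open (S \<inter> (\<lambda>z. det (h z)) -` (- {0}))"
    by (simp add: open_Compl)
  moreover have "S \<inter> (\<lambda>z. det (h z)) -` (- {0}) = {z \<in> S. invertible (h z)}"
    by (auto simp: invertible_det_nz)
  ultimately show ?thesis by simp
qed

lemma inverse_metric_scaleR:
  assumes "invertible h" "c \<noteq> 0"
  shows "inverse_metric (c *\<^sub>R h) = inverse_metric h /\<^sub>R c"
proof -
  interpret mm: bounded_bilinear "(**) :: complex^'n^'n \<Rightarrow> complex^'n^'n \<Rightarrow> complex^'n^'n"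
    by (rule bounded_bilinear_matrix_mult)
  have "invertible (transpose h)"
    using assms(1) by (simp add: invertible_det_nz det_transpose)
  then show ?thesis
    unfolding inverse_metric_def
    by (intro matrix_inv_eqI)
      (simp_all add: transpose_scaleR mm.scaleR_left mm.scaleR_right matrix_inv_left matrix_inv_right assms(2))
qed

text \<open>The antiholomorphic derivatives of the conjugate of W are the conjugates of the
  derivatives of W, so both slots of the form hold the same vector. Invertibility of the metric lets
  \<sigma> be pulled out of the inverse, as \<open>matrix_inv\<close> of a singular matrix is
  unspecified.\<close>

lemma scalar_potential_evolved:
  fixes W :: "'a \<Rightarrow> complex" and U :: "'a set" and \<phi> :: "'a \<Rightarrow> complex^'n::finite"
  defines "F \<equiv> \<lambda>w. W (inv_into U \<phi> w)"
  assumes "invertible (g (U, \<phi>) z)" "flow_factor \<Lambda> \<tau> \<noteq> 0" "F differentiable (at z)"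
  shows "scalar_potential (U, \<phi>) (evolved_metric \<Lambda> g \<tau>) W z =
    hermitian_form (inverse_metric (g (U, \<phi>) z)) (\<chi> i. wirtinger i F z) (\<chi> i. wirtinger i F z)
      / flow_factor \<Lambda> \<tau>"
proof -
  have "scalar_potential (U, \<phi>) (evolved_metric \<Lambda> g \<tau>) W z =
      hermitian_form (inverse_metric (g (U, \<phi>) z) /\<^sub>R flow_factor \<Lambda> \<tau>)
        (\<chi> i. wirtinger i F z) (\<chi> i. wirtinger i F z)"
    using assms(2-4)
    by (simp add: scalar_potential_def hermitian_form_def evolved_metric_def inverse_metric_scaleR
        wirtinger_bar_cnj F_def)
  then show ?thesis
    by (simp add: linear_scale[OF linear_hermitian_form] divide_inverse mult.commute)
qed

text \<open>Derivatives are local, so proportionality on the open set \<open>S\<close> suffices. The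
  claim \<open>*\<close> is general in both functions because the Hessian applies it a second time,
  to the partial derivatives.\<close>

lemma partial_derivatives_scaled:
  fixes f :: "complex^'n::finite \<Rightarrow> real"
  assumes S: "open S" "z \<in> S" and f: "smooth_on f S" and h: "\<And>y. y \<in> S \<Longrightarrow> h y = c * f y"
  shows "partial_derivative v h z = c * partial_derivative v f z"
    and "hessian h z = c *\<^sub>R hessian f z"
proof -
  have *: "partial_derivative v h y = c * partial_derivative v f y"
    if f: "smooth_on f S" and h: "\<And>y. y \<in> S \<Longrightarrow> h y = c * f y" and y: "y \<in> S"
    for f h :: "complex^'n \<Rightarrow> real" and v y
  proof -
    obtain D where D: "\<And>z. z \<in> S \<Longrightarrow> (f has_derivative D z) (at z)" "\<And>v. smooth_on (\<lambda>z. D z v) S"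
      using smooth_onE[OF S(1) f] by blast
    have "partial_derivative v h y = partial_derivative v (\<lambda>y. c * f y) y"
      by (rule partial_derivative_cong[OF S(1) y h])
    also have "\<dots> = c * D y v"
      by (rule partial_derivative_eq) (rule has_derivative_mult_right[OF D(1)[OF y]])
    finally show ?thesis by (simp add: partial_derivative_eq[OF D(1)[OF y]])
  qed
  show "partial_derivative v h z = c * partial_derivative v f z"
    by (rule *[OF f h S(2)])
  have "partial_derivative a (partial_derivative b h) z = c * partial_derivative a (partial_derivative b f) z" for a b
    by (rule *[OF smooth_on_partial_derivative[OF S(1) f] *[OF f h] S(2)])
  then show "hessian h z = c *\<^sub>R hessian f z"
    by (simp add: hessian_def vec_eq_iff)
qed

text \<open>The normal form leaves the signs scattered over the index type, while Morse coordinates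
  list the negative ones first. Two consecutive intervals are matched with the negative and the
  positive indices, and the bijections are glued.\<close>

lemma sign_enumeration:
  fixes s :: "'k::finite \<Rightarrow> real"
  assumes s: "\<And>i. s i = 1 \<or> s i = - 1"
  shows "\<exists>idx. bij_betw idx {1..CARD('k)} (UNIV :: 'k set) \<and>
    (\<forall>x :: 'k \<Rightarrow> real. (\<Sum>i\<in>UNIV. s i * x i) =
      - (\<Sum>k = 1..card {i. s i = - 1}. x (idx k)) + (\<Sum>k = card {i. s i = - 1} + 1..CARD('k). x (idx k)))"
proof -
  let ?N = "{i. s i = - 1}" and ?P = "{i. s i = 1}"
  have part: "?N \<union> ?P = UNIV" "?N \<inter> ?P = {}" using s by auto
  then have card: "card ?N + card ?P = CARD('k)"
    by (metis card_Un_disjoint finite)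
  obtain f where f: "bij_betw f {1..card ?N} ?N"
    using finite_same_card_bij[of "{1..card ?N}" ?N] by auto
  have "\<exists>h. bij_betw h {card ?N + 1..CARD('k)} ?P"
    by (rule finite_same_card_bij) (use card in auto)
  then obtain h where h: "bij_betw h {card ?N + 1..CARD('k)} ?P"
    by blast
  define idx where "idx = (\<lambda>k. if k \<le> card ?N then f k else h k)"
  have 1: "bij_betw idx {1..card ?N} ?N"
    using f by (rule bij_betw_cong[THEN iffD1, rotated]) (simp add: idx_def)
  have 2: "bij_betw idx {card ?N + 1..CARD('k)} ?P"
    using h by (rule bij_betw_cong[THEN iffD1, rotated]) (simp add: idx_def)
  have "{1..card ?N} \<union> {card ?N + 1..CARD('k)} = {1..CARD('k)}" using card by auto
  then have bij: "bij_betw idx {1..CARD('k)} UNIV"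
    using bij_betw_combine[OF 1 2 part(2)] part(1) by simp
  show ?thesis
  proof (intro exI[of _ idx] conjI bij allI)
    fix x :: "'k \<Rightarrow> real"
    have "(\<Sum>i\<in>UNIV. s i * x i) = (\<Sum>i\<in>?N. s i * x i) + (\<Sum>i\<in>?P. s i * x i)"
      using sum.union_disjoint[of ?N ?P "\<lambda>i. s i * x i"] part by simp
    also have "\<dots> = - (\<Sum>i\<in>?N. x i) + (\<Sum>i\<in>?P. x i)"
      by (simp add: sum_negf)
    also have "\<dots> = - (\<Sum>k = 1..card ?N. x (idx k)) + (\<Sum>k = card ?N + 1..CARD('k). x (idx k))"
      by (simp only: sum.reindex_bij_betw[OF 1] sum.reindex_bij_betw[OF 2])
    finally show "(\<Sum>i\<in>UNIV. s i * x i) =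
      - (\<Sum>k = 1..card ?N. x (idx k)) + (\<Sum>k = card ?N + 1..CARD('k). x (idx k))" .
  qed
qed

text \<open>\<open>S\<close>, \<open>u\<close> and \<open>Q\<close> are fixed before \<tau>, so
  everything built from them is shared by the times on both sides of the singular one.\<close>

lemma scalar_potential_quadratic_form:
  fixes A :: "('a, 'n::finite) chart set" and \<phi> :: "'a \<Rightarrow> complex^'n"
  assumes M: "complex_manifold M A" and g: "kaehler_metric A g" and W: "holomorphic_function A W"
    and c: "(U, \<phi>) \<in> A" "p \<in> U" and inv: "invertible (g (U, \<phi>) (\<phi> p))"
    and vac: "supersymmetric_vacuum (U, \<phi>) W p"
  obtains S and u :: "complex^'n \<Rightarrow> real^('n + 'n)" and Q where
    "open S" "\<phi> p \<in> S" "S \<subseteq> \<phi> ` U" "smooth_on u S" "u (\<phi> p) = 0" "smooth_on Q S"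
    "\<And>z. transpose (Q z) = Q z"
    "\<And>\<tau> z. z \<in> S \<Longrightarrow> flow_factor \<Lambda> \<tau> \<noteq> 0 \<Longrightarrow>
      scalar_potential (U, \<phi>) (evolved_metric \<Lambda> g \<tau>) W z = (u z \<bullet> (Q z *v u z)) / flow_factor \<Lambda> \<tau>"
proof -
  obtain S0 where S0: "open S0" "\<phi> p \<in> S0" "S0 \<subseteq> \<phi> ` U" "smooth_on (g (U, \<phi>)) S0"
    using kaehler_metric_smooth_near[OF g c] by blast
  \<comment> \<open>The inverse metric is meaningful and smooth only here; the set is open because
    the determinant is continuous.\<close>
  define S where "S = {z \<in> S0. invertible (g (U, \<phi>) z)}"
  have S: "open S" "\<phi> p \<in> S" "S \<subseteq> S0"
    using open_invertible[OF S0(1) smooth_on_continuous_on[OF S0(4)]] S0(2) inv by (auto simp: S_def)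
  define F where "F = (\<lambda>w. W (inv_into U \<phi> w))"
  have "open (\<phi> ` U)"
    using M c unfolding complex_manifold_def local_coordinates_def by blast
  moreover have "multi_holomorphic_on F (\<phi> ` U)"
    using W c unfolding holomorphic_function_def F_def by blast
  ultimately have "smooth_on F (\<phi> ` U)"
    by (rule multi_holomorphic_smooth_on)
  then have F: "smooth_on F S"
    by (rule smooth_on_subset) (use S(3) S0(3) in blast)
  define w where "w = (\<lambda>z. \<chi> i. wirtinger i F z)"
  have w: "smooth_on w S"
    unfolding w_def by (intro smooth_on_vec_lambda smooth_on_wirtinger F S(1))
  define G where "G = (\<lambda>z. inverse_metric (g (U, \<phi>) z))"
  have G: "smooth_on G S"
    unfolding G_def inverse_metric_def
  proof (rule smooth_on_matrix_inv[OF S(1)])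
    show "smooth_on (\<lambda>z. transpose (g (U, \<phi>) z)) S"
      by (rule smooth_on_linear_compose[OF S(1) bounded_linear_transpose smooth_on_subset[OF S0(4) S(3)]])
  qed (simp add: S_def invertible_det_nz det_transpose)
  show ?thesis
  proof (rule that[of S "\<lambda>z. real_coords (w z)" "\<lambda>z. real_form (G z)"])
    show "smooth_on (\<lambda>z. real_coords (w z)) S"
      using linear_real_coords
      by (intro smooth_on_linear_compose[OF S(1) _ w]) (simp add: linear_conv_bounded_linear)
    show "smooth_on (\<lambda>z. real_form (G z)) S"
      by (rule smooth_on_linear_compose[OF S(1) bounded_linear_real_form G])
    have "w (\<phi> p) = 0"
      using vac by (simp add: supersymmetric_vacuum_def w_def F_def vec_eq_iff)
    then show "real_coords (w (\<phi> p)) = 0"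
      by (simp add: linear_0[OF linear_real_coords])
    fix \<tau> z assume z: "z \<in> S" and \<tau>: "flow_factor \<Lambda> \<tau> \<noteq> 0"
    obtain D where D: "\<And>z. z \<in> S \<Longrightarrow> (F has_derivative D z) (at z)" "\<And>v. smooth_on (\<lambda>z. D z v) S"
      using smooth_onE[OF S(1) F] by blast
    have "F differentiable (at z)"
      using D(1)[OF z] by (rule differentiableI)
    moreover have "invertible (g (U, \<phi>) z)" using z by (simp add: S_def)
    ultimately show "scalar_potential (U, \<phi>) (evolved_metric \<Lambda> g \<tau>) W z =
        (real_coords (w z) \<bullet> (real_form (G z) *v real_coords (w z))) / flow_factor \<Lambda> \<tau>"
      using scalar_potential_evolved[of g U \<phi> z \<Lambda> \<tau> W] \<tau>
      by (simp add: F_def w_def G_def hermitian_form_real_form)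
  qed (use S S0 transpose_real_form in auto)
qed

theorem theorem5p3:
  fixes M :: "'a topology"
    and A :: "('a, 'n::finite) chart set"
    and g :: "('a, 'n) metric"
    and W :: "'a \<Rightarrow> complex"
    and U :: "'a set" and \<phi> :: "'a \<Rightarrow> complex^'n"
    and p\<^sub>0 :: 'a
    and \<Lambda> \<tau>\<^sub>0 :: real
    and l :: nat
  defines "\<sigma> \<equiv> flow_factor \<Lambda>"
    and "V \<equiv> \<lambda>\<tau>. scalar_potential (U, \<phi>) (evolved_metric \<Lambda> g \<tau>) W"
  assumes "complex_manifold M A"
    and "kaehler_einstein A \<Lambda> g"
    and "holomorphic_function A W"
    and "\<Lambda> > 0"
    and "(U, \<phi>) \<in> A" and "p\<^sub>0 \<in> U"
    and "invertible (g (U, \<phi>) (\<phi> p\<^sub>0))"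
    and "supersymmetric_vacuum (U, \<phi>) W p\<^sub>0"
    and "0 \<le> \<tau>\<^sub>0" and "\<tau>\<^sub>0 < 1 / (2 * \<Lambda>)"
    and "nondegenerate_critical_point (V \<tau>\<^sub>0) (\<phi> p\<^sub>0)"
    and "morse_index (V \<tau>\<^sub>0) (\<phi> p\<^sub>0) = l"
  shows "(\<forall>\<tau>. 0 \<le> \<tau> \<and> \<tau> < 1 / (2 * \<Lambda>) \<longrightarrow>
            nondegenerate_critical_point (V \<tau>) (\<phi> p\<^sub>0) \<and>
            morse_index (V \<tau>) (\<phi> p\<^sub>0) = l)
    \<and> (\<forall>\<tau>. \<tau> > 1 / (2 * \<Lambda>) \<longrightarrow>
            nondegenerate_critical_point (V \<tau>) (\<phi> p\<^sub>0) \<and>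
            morse_index (V \<tau>) (\<phi> p\<^sub>0) = 2 * CARD('n) - l)
    \<and> (\<forall>\<tau> \<tau>'. 0 \<le> \<tau> \<and> \<tau> < 1 / (2 * \<Lambda>) \<and> \<tau>' > 1 / (2 * \<Lambda>) \<longrightarrow>
            (\<exists>r>0. hessian (V \<tau>') (\<phi> p\<^sub>0) = - (r *\<^sub>R hessian (V \<tau>) (\<phi> p\<^sub>0))))
    \<and> (\<exists>N (X :: real \<Rightarrow> 'a \<Rightarrow> real^('n + 'n)) idx.
            p\<^sub>0 \<in> N \<and> N \<subseteq> U \<and> bij_betw idx {1..2 * CARD('n)} UNIV \<and>
            (\<forall>\<tau>. 0 \<le> \<tau> \<and> \<tau> \<noteq> 1 / (2 * \<Lambda>) \<longrightarrow>
               real_coordinates M A N (X \<tau>) \<and>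
               (\<forall>p\<in>N.
                  X \<tau> p = (\<bar>\<sigma> \<tau>\<bar> powr (- 1 / 2)) *\<^sub>R X 0 p \<and>
                  V \<tau> (\<phi> p) =
                    (if \<tau> < 1 / (2 * \<Lambda>) then 1 else - 1) *
                    (- (\<Sum>k = 1..l. (X \<tau> p $ idx k)\<^sup>2)
                     + (\<Sum>k = l + 1..2 * CARD('n). (X \<tau> p $ idx k)\<^sup>2)))))"
proof -
  note M = assms(3) and W = assms(5) and \<Lambda> = assms(6) and c = assms(7,8)
  have g: "kaehler_metric A g" using assms(4) by (simp add: kaehler_einstein_def)
  have \<sigma>_pos: "\<sigma> \<tau> > 0 \<longleftrightarrow> \<tau> < 1 / (2 * \<Lambda>)" and \<sigma>_neg: "\<sigma> \<tau> < 0 \<longleftrightarrow> \<tau> > 1 / (2 * \<Lambda>)" for \<tau>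
    using \<Lambda> by (auto simp: \<sigma>_def flow_factor_def field_simps)
  then have \<sigma>0: "\<sigma> \<tau> \<noteq> 0 \<longleftrightarrow> \<tau> \<noteq> 1 / (2 * \<Lambda>)" for \<tau>
    by (metis linorder_neqE_linordered_idom order_less_irrefl)
  define z0 where "z0 = \<phi> p\<^sub>0"
  obtain S and u :: "complex^'n \<Rightarrow> real^('n + 'n)" and Q where
    S: "open S" "\<phi> p\<^sub>0 \<in> S" "S \<subseteq> \<phi> ` U" and u: "smooth_on u S" "u (\<phi> p\<^sub>0) = 0"
    and Q: "smooth_on Q S" "\<And>z. transpose (Q z) = Q z"
    and V0: "\<And>\<tau> z. z \<in> S \<Longrightarrow> flow_factor \<Lambda> \<tau> \<noteq> 0 \<Longrightarrow>
      scalar_potential (U, \<phi>) (evolved_metric \<Lambda> g \<tau>) W z = (u z \<bullet> (Q z *v u z)) / flow_factor \<Lambda> \<tau>"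
    using scalar_potential_quadratic_form[OF M g W c assms(9,10)] by blast
  define f where "f = (\<lambda>z. u z \<bullet> (Q z *v u z))"
  have V: "V \<tau> z = (1 / \<sigma> \<tau>) * f z" if "z \<in> S" "\<sigma> \<tau> \<noteq> 0" for \<tau> z
    using V0 that by (simp add: V_def \<sigma>_def f_def)
  have f: "smooth_on f S"
    unfolding f_def
    by (intro smooth_on_bilinear[OF S(1) bounded_bilinear_inner] u(1)
        smooth_on_bilinear[OF S(1) bounded_bilinear_matrix_vector_mult] Q(1))
  let ?H = "hessian f z0"
  have H: "hessian (V \<tau>) z0 = (1 / \<sigma> \<tau>) *\<^sub>R ?H"
    and dV: "partial_derivative v (V \<tau>) z0 = (1 / \<sigma> \<tau>) * partial_derivative v f z0"
    if "\<sigma> \<tau> \<noteq> 0" for \<tau> v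
    using partial_derivatives_scaled[OF S(1,2) f V[OF _ that]] by (simp_all add: z0_def)
  \<comment> \<open>Nondegeneracy and the index are given at the single time
    \<open>\<tau>\<^sub>0\<close>. Division by the positive \<sigma> there transfers them to
    \<open>f\<close>, and from \<open>f\<close> they pass to every other time.\<close>
  have \<tau>0: "\<sigma> \<tau>\<^sub>0 > 0" using assms(12) \<sigma>_pos by simp
  have "invertible (hessian (V \<tau>\<^sub>0) z0)"
    using assms(13) by (simp add: nondegenerate_critical_point_def z0_def)
  then have inv: "invertible ?H"
    using H[of \<tau>\<^sub>0] \<tau>0 by (simp add: invertible_scaleR)
  obtain s T and X :: "complex^'n \<Rightarrow> real^('n + 'n)" and G where
    crit: "\<And>b. partial_derivative b f z0 = 0" and s: "\<And>i. s i = 1 \<or> s i = - 1"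
    and cnt: "\<And>c. c > 0 \<Longrightarrow> negative_eigenvalue_count (c *\<^sub>R ?H) = card {i. s i = - 1}"
      "\<And>c. c < 0 \<Longrightarrow> negative_eigenvalue_count (c *\<^sub>R ?H) = 2 * CARD('n) - card {i. s i = - 1}"
    and T: "open T" "T \<subseteq> S" "z0 \<in> T"
    and X: "open (X ` T)" "homeomorphism T (X ` T) X G" "smooth_on X T" "smooth_on G (X ` T)"
    and fX: "\<And>z. z \<in> T \<Longrightarrow> f z = (\<Sum>i\<in>UNIV. s i * (X z $ i)\<^sup>2)"
    using morse_normal_form[OF S(1) S(2)[folded z0_def] u(1) u(2)[folded z0_def] Q f_def[THEN fun_cong] inv]
    by blast
  have l: "card {i. s i = - 1} = l"
    using assms(14) H[of \<tau>\<^sub>0] cnt(1)[of "1 / \<sigma> \<tau>\<^sub>0"] \<tau>0 by (simp add: morse_index_def z0_def)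
  have nondeg: "nondegenerate_critical_point (V \<tau>) z0" if "\<sigma> \<tau> \<noteq> 0" for \<tau>
    using H[OF that] dV[OF that] inv that
    by (simp add: nondegenerate_critical_point_def crit invertible_scaleR)
  have index: "morse_index (V \<tau>) z0 = (if \<sigma> \<tau> > 0 then l else 2 * CARD('n) - l)" if "\<sigma> \<tau> \<noteq> 0" for \<tau>
    using H[OF that] cnt[of "1 / \<sigma> \<tau>"] that by (auto simp: morse_index_def l)
  have parity: "\<exists>r>0. hessian (V \<tau>') z0 = - (r *\<^sub>R hessian (V \<tau>) z0)" if "\<sigma> \<tau> > 0" "\<sigma> \<tau>' < 0" for \<tau> \<tau>'
  proof (intro exI conjI)
    \<comment> \<open>The two Hessians are \<open>?H\<close> divided by \<sigma> \<tau> and by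
      \<sigma> \<tau>'. Their ratio \<sigma> \<tau> / \<sigma> \<tau>' is negative, and r is its
      modulus.\<close>
    show "- (\<sigma> \<tau> / \<sigma> \<tau>') > 0" using that by (simp add: divide_pos_neg)
    show "hessian (V \<tau>') z0 = - (- (\<sigma> \<tau> / \<sigma> \<tau>') *\<^sub>R hessian (V \<tau>) z0)"
      using that by (simp add: H)
  qed
  obtain idx where idx: "bij_betw idx {1..CARD('n + 'n)} (UNIV :: ('n + 'n) set)"
    and sum_idx: "\<forall>x. (\<Sum>i\<in>UNIV. s i * x i) =
      - (\<Sum>k = 1..l. x (idx k)) + (\<Sum>k = l + 1..CARD('n + 'n). x (idx k))"
    using sign_enumeration[of s, OF s] unfolding l by (elim exE conjE)
  define N where "N = {p \<in> U. \<phi> p \<in> T}"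
  \<comment> \<open>Squaring the scale factor gives 1 / |\<sigma>|, so the squares of the
    coordinates account for 1 / \<sigma> up to its sign, which is the prefactor in the
    claim.\<close>
  define Y where "Y = (\<lambda>\<tau> p. (\<bar>\<sigma> \<tau>\<bar> powr (- 1 / 2)) *\<^sub>R X (\<phi> p))"
  have TU: "T \<subseteq> \<phi> ` U" using T(2) S(3) by blast
  have Y: "real_coordinates M A N (Y \<tau>)" if "\<sigma> \<tau> \<noteq> 0" for \<tau>
  proof -
    have "\<bar>\<sigma> \<tau>\<bar> powr (- 1 / 2) \<noteq> 0" using that by simp
    from scaled_coordinates[OF this T(1) X(2,1,3,4)]
    show ?thesis
      unfolding Y_def N_def by (intro real_coordinates_compose[OF M c(1) T(1) TU])
  qed
  \<comment> \<open>At time 0 the flow factor is 1, so the unscaled coordinates are those of the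
    initial time.\<close>
  have Y0: "Y 0 p = X (\<phi> p)" for p
    by (simp add: Y_def \<sigma>_def flow_factor_def)
  have VY: "V \<tau> (\<phi> p) = (if \<tau> < 1 / (2 * \<Lambda>) then 1 else - 1) *
      (- (\<Sum>k = 1..l. (Y \<tau> p $ idx k)\<^sup>2) + (\<Sum>k = l + 1..2 * CARD('n). (Y \<tau> p $ idx k)\<^sup>2))"
    if "\<sigma> \<tau> \<noteq> 0" "p \<in> N" for \<tau> p
  proof -
    have p: "\<phi> p \<in> T" using that(2) by (simp add: N_def)
    define r where "r = \<bar>\<sigma> \<tau>\<bar> powr (- 1 / 2)"
    have "r\<^sup>2 = \<bar>\<sigma> \<tau>\<bar> powr (- 1)"
      by (simp add: r_def power2_eq_square powr_add[symmetric])
    then have sq: "r\<^sup>2 = 1 / \<bar>\<sigma> \<tau>\<bar>"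
      using that(1) by (simp add: powr_minus_divide)
    have Y_nth: "Y \<tau> p $ i = r * X (\<phi> p) $ i" for i
      by (simp add: Y_def r_def)
    have "- (\<Sum>k = 1..l. (Y \<tau> p $ idx k)\<^sup>2) + (\<Sum>k = l + 1..2 * CARD('n). (Y \<tau> p $ idx k)\<^sup>2)
        = (\<Sum>i\<in>UNIV. s i * (Y \<tau> p $ i)\<^sup>2)"
      using sum_idx[THEN spec, of "\<lambda>i. (Y \<tau> p $ i)\<^sup>2"] by (simp add: mult_2)
    also have "\<dots> = (1 / \<bar>\<sigma> \<tau>\<bar>) * f (\<phi> p)"
      by (simp add: Y_nth power_mult_distrib sq fX[OF p] sum_distrib_left mult_ac)
    finally show ?thesis
      using V[of "\<phi> p" \<tau>] p T(2) that(1) \<sigma>_pos[of \<tau>] by auto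
  qed
  show ?thesis
  proof (intro conjI)
    show "\<forall>\<tau>. 0 \<le> \<tau> \<and> \<tau> < 1 / (2 * \<Lambda>) \<longrightarrow>
        nondegenerate_critical_point (V \<tau>) (\<phi> p\<^sub>0) \<and> morse_index (V \<tau>) (\<phi> p\<^sub>0) = l"
      using nondeg index \<sigma>_pos unfolding z0_def by (metis less_irrefl)
    show "\<forall>\<tau>. \<tau> > 1 / (2 * \<Lambda>) \<longrightarrow> nondegenerate_critical_point (V \<tau>) (\<phi> p\<^sub>0) \<and>
        morse_index (V \<tau>) (\<phi> p\<^sub>0) = 2 * CARD('n) - l"
      using nondeg index \<sigma>_neg unfolding z0_def by (metis less_irrefl less_asym)
    show "\<forall>\<tau> \<tau>'. 0 \<le> \<tau> \<and> \<tau> < 1 / (2 * \<Lambda>) \<and> \<tau>' > 1 / (2 * \<Lambda>) \<longrightarrow>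
        (\<exists>r>0. hessian (V \<tau>') (\<phi> p\<^sub>0) = - (r *\<^sub>R hessian (V \<tau>) (\<phi> p\<^sub>0)))"
      using parity \<sigma>_pos \<sigma>_neg unfolding z0_def by blast
    have "p\<^sub>0 \<in> N" "N \<subseteq> U" using c(2) T(3) by (auto simp: N_def z0_def)
    moreover have "bij_betw idx {1..2 * CARD('n)} UNIV" using idx by (simp add: mult_2)
    ultimately show "\<exists>N (X :: real \<Rightarrow> 'a \<Rightarrow> real^('n + 'n)) idx.
        p\<^sub>0 \<in> N \<and> N \<subseteq> U \<and> bij_betw idx {1..2 * CARD('n)} UNIV \<and>
        (\<forall>\<tau>. 0 \<le> \<tau> \<and> \<tau> \<noteq> 1 / (2 * \<Lambda>) \<longrightarrow>
           real_coordinates M A N (X \<tau>) \<and>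
           (\<forall>p\<in>N.
              X \<tau> p = (\<bar>\<sigma> \<tau>\<bar> powr (- 1 / 2)) *\<^sub>R X 0 p \<and>
              V \<tau> (\<phi> p) =
                (if \<tau> < 1 / (2 * \<Lambda>) then 1 else - 1) *
                (- (\<Sum>k = 1..l. (X \<tau> p $ idx k)\<^sup>2)
                 + (\<Sum>k = l + 1..2 * CARD('n). (X \<tau> p $ idx k)\<^sup>2))))"
    proof (intro exI[of _ N] exI[of _ Y] exI[of _ idx] conjI allI impI ballI)
      fix \<tau> assume "0 \<le> \<tau> \<and> \<tau> \<noteq> 1 / (2 * \<Lambda>)"
      then have \<tau>: "\<sigma> \<tau> \<noteq> 0" using \<sigma>0 by simp
      show "real_coordinates M A N (Y \<tau>)" by (rule Y[OF \<tau>])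
      fix p assume p: "p \<in> N"
      show "Y \<tau> p = (\<bar>\<sigma> \<tau>\<bar> powr (- 1 / 2)) *\<^sub>R Y 0 p"
        unfolding Y0 by (simp add: Y_def)
      show "V \<tau> (\<phi> p) = (if \<tau> < 1 / (2 * \<Lambda>) then 1 else - 1) *
          (- (\<Sum>k = 1..l. (Y \<tau> p $ idx k)\<^sup>2) + (\<Sum>k = l + 1..2 * CARD('n). (Y \<tau> p $ idx k)\<^sup>2))"
        by (rule VY[OF \<tau> p])
    qed
  qed
qed

end
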